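(* Let $n\ge 2$, $d\ge 2$ and $r\ge 1$ be integers, and let $V_n^d=\nu_d(\mathbb{P}^n)$ be the $d$-th Veronese variety. Then $$\mathcal{E}_r(V_n^d)\text{ and }\tilde{\mathcal{E}}_r(V_n^d)\text{ are nonempty if and only if } r\ge d$$ (that is, both are nonempty if $r\ge d$, and both are empty if $r<d$).
   Context: The base field is $\mathbb{C}$. $\nu_d:\mathbb{P}^n\to\mathbb{P}^N$, $N=\binom{n+d}{d}-1$, is the Veronese embedding given by the complete linear system $|\mathcal{O}_{\mathbb{P}^n}(d)|$. For an integral nondegenerate variety $X\subset\mathbb{P}^N$, $X_{\mathrm{sm}}$ is its smooth locus and $\mathcal{S}_r(X)$ is the set of (unordered) sets of $r$ distinct smooth points of $X$. For a finite $A\subset X_{\mathrm{sm}}$, $2A$ is the zero-dimensional scheme with ideal sheaf $(\mathcal{I}_{A,X})^2$, and $\langle 2A\rangle\subseteq\mathbb{P}^N$ is its linear span, i.e. the span of the union of the tangent spaces $T_pX$, $p\in A$. The $r$-th strong base locus of $X$ is $$\mathcal{E}_r(X)=\{A\in\mathcal{S}_r(X)\mid \langle 2A\rangle\neq\mathbb{P}^N\text{ and }\langle 2(A\cup\{q\})\rangle=\langle 2A\rangle\text{ for some }q\in X_{\mathrm{sm}}\setminus A\}.$$ The tangential contact locus of $A$ is $C(A)=\mathrm{Sing}(\langle 2A\rangle\cap X_{\mathrm{sm}})$, meaning the set of $x\in X_{\mathrm{sm}}$ with $T_xX\subseteq\langle 2A\rangle$, and $$\tilde{\mathcal{E}}_r(X)=\{A\in\mathcal{S}_r(X)\mid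 \langle 2A\rangle\neq\mathbb{P}^N\text{ and }\dim C(A)>0\}.$$ *)

theory Defs
  imports "HOL-Analysis.Analysis" "HOL-Library.Function_Algebras" "HOL-Library.Extended_Nat"
begin

(* Homogeneous coordinates are indexed by a finite set I: the vector space over the complex
   numbers underlying the projective space with coordinates I consists of the functions that
   vanish outside I.  Points are one-dimensional linear subspaces, and a linear subspace of
   projective space is represented by its affine cone, a subspace of coord_space I. *)

global_interpretation cvec: vector_space "\<lambda>(c::complex) (v::'i \<Rightarrow> complex) i. c * v i"
  by unfold_locales (auto simp: fun_eq_iff algebra_simps)

definition coord_space :: "'i set \<Rightarrow> ('i \<Rightarrow> complex) set" where
  "coord_space I = {v. \<forall>i. i \<notin> I \<longrightarrow> v i = 0}"

type_synonym 'i point = "('i \<Rightarrow> complex) set"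

definition proj_space :: "'i set \<Rightarrow> 'i point set" where
  "proj_space I = {cvec.span {v} | v. v \<in> coord_space I \<and> v \<noteq> 0}"

definition exponents :: "'i set \<Rightarrow> nat \<Rightarrow> ('i \<Rightarrow> nat) set" where
  "exponents I e = {\<alpha>. (\<forall>i. i \<notin> I \<longrightarrow> \<alpha> i = 0) \<and> (\<Sum>i\<in>I. \<alpha> i) = e}"

definition monom_eval :: "'i set \<Rightarrow> ('i \<Rightarrow> nat) \<Rightarrow> ('i \<Rightarrow> complex) \<Rightarrow> complex" where
  "monom_eval I \<alpha> v = (\<Prod>i\<in>I. v i ^ \<alpha> i)"

(* Homogeneous polynomials of degree e as functions; nothing is lost over an infinite field. *)
definition forms :: "'i set \<Rightarrow> nat \<Rightarrow> (('i \<Rightarrow> complex) \<Rightarrow> complex) set" where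
  "forms I e = {\<lambda>v. \<Sum>\<alpha>\<in>exponents I e. c \<alpha> * monom_eval I \<alpha> v | c. True}"

definition vanishes_on :: "(('i \<Rightarrow> complex) \<Rightarrow> complex) \<Rightarrow> 'i point set \<Rightarrow> bool" where
  "vanishes_on F X \<longleftrightarrow> (\<forall>p\<in>X. \<forall>v\<in>p - {0}. F v = 0)"

(* The complements of the hypersurfaces F = 0 form a basis of the Zariski topology. *)
definition zariski :: "'i set \<Rightarrow> 'i point topology" where
  "zariski I = topology_generated_by
     {{p \<in> proj_space I. \<not> vanishes_on F {p}} | F. \<exists>e. F \<in> forms I e}"

definition irreducible_in :: "'a topology \<Rightarrow> 'a set \<Rightarrow> bool" where
  "irreducible_in T Z \<longleftrightarrow> Z \<noteq> {} \<and> Z \<subseteq> topspace T \<and>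
     (\<forall>C D. closedin T C \<and> closedin T D \<and> Z \<subseteq> C \<union> D \<longrightarrow> Z \<subseteq> C \<or> Z \<subseteq> D)"

(* Since Sup {} = 0 in enat, the empty space gets dimension 0. *)
definition krull_dim :: "'a topology \<Rightarrow> enat" where
  "krull_dim T = Sup {enat k | k. \<exists>Z::nat \<Rightarrow> 'a set.
     (\<forall>i\<le>k. closedin T (Z i) \<and> irreducible_in T (Z i)) \<and> (\<forall>i<k. Z i \<subset> Z (Suc i))}"

definition zdim :: "'i set \<Rightarrow> 'i point set \<Rightarrow> enat" where
  "zdim I S = krull_dim (subtopology (zariski I) S)"

(* The embedded projective tangent space (its affine cone): the vectors w with dF_v(w) = 0 for
   all homogeneous F in the ideal of X, where v represents p. *)
definition tangent_space :: "'i set \<Rightarrow> 'i point set \<Rightarrow> 'i point \<Rightarrow> ('i \<Rightarrow> complex) set" where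
  "tangent_space I X p = {w \<in> coord_space I.
     \<forall>e. \<forall>F\<in>forms I e. vanishes_on F X \<longrightarrow>
       (\<forall>v\<in>p - {0}. ((\<lambda>t::complex. F (\<lambda>i. v i + t * w i)) has_field_derivative 0) (at 0))}"

(* For irreducible X; the summand 1 is due to the affine cone. *)
definition smooth_locus :: "'i set \<Rightarrow> 'i point set \<Rightarrow> 'i point set" where
  "smooth_locus I X = {p \<in> X. enat (cvec.dim (tangent_space I X p)) = zdim I X + 1}"

definition smooth_subsets :: "'i set \<Rightarrow> 'i point set \<Rightarrow> nat \<Rightarrow> 'i point set set" where
  "smooth_subsets I X r = {A. A \<subseteq> smooth_locus I X \<and> finite A \<and> card A = r}"

(* The span of the double points 2A of X. *)
definition double_span :: "'i set \<Rightarrow> 'i point set \<Rightarrow> 'i point set \<Rightarrow> ('i \<Rightarrow> complex) set" where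
  "double_span I X A = cvec.span (\<Union>p\<in>A. tangent_space I X p)"

definition strong_base_locus :: "'i set \<Rightarrow> 'i point set \<Rightarrow> nat \<Rightarrow> 'i point set set" where
  "strong_base_locus I X r = {A \<in> smooth_subsets I X r.
     double_span I X A \<noteq> coord_space I \<and>
     (\<exists>q \<in> smooth_locus I X - A. double_span I X (A \<union> {q}) = double_span I X A)}"

definition contact_locus :: "'i set \<Rightarrow> 'i point set \<Rightarrow> 'i point set \<Rightarrow> 'i point set" where
  "contact_locus I X A = {x \<in> smooth_locus I X. tangent_space I X x \<subseteq> double_span I X A}"

definition contact_base_locus :: "'i set \<Rightarrow> 'i point set \<Rightarrow> nat \<Rightarrow> 'i point set set" where
  "contact_base_locus I X r = {A \<in> smooth_subsets I X r.
     double_span I X A \<noteq> coord_space I \<and> zdim I (contact_locus I X A) > 0}"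

(* Projective n-space has coordinates {0..n}; the target of the Veronese embedding has as
   coordinates the monomials of degree d, of which there are (n + d choose d). *)
definition veronese_vec :: "nat \<Rightarrow> nat \<Rightarrow> (nat \<Rightarrow> complex) \<Rightarrow> ((nat \<Rightarrow> nat) \<Rightarrow> complex)" where
  "veronese_vec n d v = (\<lambda>\<alpha>. if \<alpha> \<in> exponents {0..n} d then monom_eval {0..n} \<alpha> v else 0)"

(* veronese_vec is homogeneous of degree d, so the span below is again a line. *)
definition veronese_map :: "nat \<Rightarrow> nat \<Rightarrow> nat point \<Rightarrow> (nat \<Rightarrow> nat) point" where
  "veronese_map n d p = cvec.span (veronese_vec n d ` p)"

definition veronese_variety :: "nat \<Rightarrow> nat \<Rightarrow> (nat \<Rightarrow> nat) point set" where
  "veronese_variety n d = veronese_map n d ` proj_space {0..n}"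

end

theory Submission
  imports Defs
begin

text \<open>A linear functional on the target of the Veronese embedding is a form \<open>F\<close> of degree \<open>d\<close>,
  and it annihilates the tangent space at the image of \<open>v\<close> iff \<open>F\<close> is singular at \<open>v\<close>.  For
  \<open>r \<ge> d\<close> take \<open>r\<close> points on a line: the derivatives of a form that is singular at these points
  have degree \<open>d - 1\<close> and vanish at \<open>d\<close> points of the line, hence on all of it, so that the whole
  line lies in the contact locus; the form \<open>x\<^sub>0\<^bsup>d-2\<^esup> x\<^sub>2\<^bsup>2\<^esup>\<close> shows that the span is proper.  For
  \<open>r < d\<close> a product of linear forms is singular at the \<open>r\<close> given points but not at another given
  point, hence the contact locus is the finite set itself.

  Smoothness of the Veronese variety needs its tangent spaces, which binomial equations cut down to
  the image of the derivative, and its Krull dimension.  The latter is bounded by counting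
  monomials: a chain of more than \<open>n + 1\<close> irreducible closed sets would give more than \<open>n + 1\<close>
  algebraically independent forms in \<open>n + 1\<close> variables.\<close>

section \<open>Forms\<close>

text \<open>The threshold is a matter of degree. Making a form singular at each point separately
  costs the square of a linear form per point, which handles only about half of \<open>d\<close>
  points. To reach \<open>d - 1\<close> points, one square has to serve two points at once. This
  fails exactly for points collinear with the point to be avoided; there a linear form through the
  common line supplies one zero at every point, while being only a simple zero at the avoided point.
  With \<open>d\<close> points on a line, in contrast, derivatives of degree \<open>d - 1\<close>
  already have too many zeros.

  Smoothness compares the affine tangent dimension with a Krull dimension, so the dimension of the
  variety must be known exactly. Products of \<open>n + 1\<close> independent forms with exponents
  up to \<open>q\<close> number about q^(n+1), whereas forms of degree proportional to
  \<open>q\<close> in \<open>n + 1\<close> homogeneous variables span a space whose dimension grows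
  only like q^n. The lower bound uses images of coordinate subspaces, and is formulated for subsets
  so that it also applies to contact loci.\<close>

lemma exponents_add:
  "\<alpha> \<in> exponents I d \<Longrightarrow> \<beta> \<in> exponents I e \<Longrightarrow> (\<lambda>i. \<alpha> i + \<beta> i) \<in> exponents I (d + e)"
  by (auto simp: exponents_def sum.distrib)

lemma finite_exponents:
  assumes "finite I" shows "finite (exponents I e)"
proof (rule finite_subset)
  show "exponents I e \<subseteq> {\<alpha>. \<forall>i. (i \<in> I \<longrightarrow> \<alpha> i \<in> {..e}) \<and> (i \<notin> I \<longrightarrow> \<alpha> i = 0)}"
    using assms by (auto simp: exponents_def intro: member_le_sum)
  show "finite {\<alpha>::'a \<Rightarrow> nat. \<forall>i. (i \<in> I \<longrightarrow> \<alpha> i \<in> {..e}) \<and> (i \<notin> I \<longrightarrow> \<alpha> i = 0)}"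
    using assms by (intro finite_set_of_finite_funs) auto
qed

text \<open>The total degree recovers entry 0 from the others, so the bound has exponent
  \<open>n\<close> although there are \<open>n + 1\<close> variables. The dimension count lives on
  this gap of one.\<close>

lemma card_exponents_le: "card (exponents {0..n} e) \<le> (e + 1) ^ n"
proof -
  have inj: "inj_on (\<lambda>\<alpha>. restrict \<alpha> {1..n}) (exponents {0..n} e)"
  proof (rule inj_onI)
    fix \<alpha> \<beta> :: "nat \<Rightarrow> nat"
    assume a: "\<alpha> \<in> exponents {0..n} e" and b: "\<beta> \<in> exponents {0..n} e"
      and eq: "restrict \<alpha> {1..n} = restrict \<beta> {1..n}"
    have pos: "\<alpha> i = \<beta> i" if "i \<in> {1..n}" for i
      using fun_cong[OF eq, of i] that by simp
    have "\<alpha> 0 + sum \<alpha> {1..n} = \<beta> 0 + sum \<beta> {1..n}"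
      using a b by (auto simp: exponents_def sum.atLeast_Suc_atMost)
    moreover have "sum \<alpha> {1..n} = sum \<beta> {1..n}" using pos by (intro sum.cong) auto
    ultimately have "\<alpha> 0 = \<beta> 0" by simp
    show "\<alpha> = \<beta>"
    proof
      fix i
      consider "i = 0" | "i \<in> {1..n}" | "i \<notin> {0..n}" by force
      then show "\<alpha> i = \<beta> i"
        using a b pos \<open>\<alpha> 0 = \<beta> 0\<close> by cases (auto simp: exponents_def)
    qed
  qed
  have "(\<lambda>\<alpha>. restrict \<alpha> {1..n}) ` exponents {0..n} e \<subseteq> PiE {1..n} (\<lambda>_. {0..e})"
  proof clarify
    fix \<alpha> assume "\<alpha> \<in> exponents {0..n} e"
    then have e: "sum \<alpha> {0..n} = e" by (simp add: exponents_def)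
    have "\<alpha> i \<le> e" if "i \<in> {1..n}" for i
      using that member_le_sum[of i "{0..n}" \<alpha>] by (simp add: e)
    then show "restrict \<alpha> {1..n} \<in> PiE {1..n} (\<lambda>_. {0..e})"
      by (simp add: PiE_iff)
  qed
  from card_mono[OF _ this] have "card ((\<lambda>\<alpha>. restrict \<alpha> {1..n}) ` exponents {0..n} e) \<le> (e + 1) ^ n"
    by (simp add: finite_PiE card_PiE)
  then show ?thesis unfolding card_image[OF inj] .
qed

lemma monom_eval_add: "monom_eval I (\<lambda>i. \<alpha> i + \<beta> i) v = monom_eval I \<alpha> v * monom_eval I \<beta> v"
  by (simp add: monom_eval_def power_add prod.distrib)

lemma monom_eval_scale:
  "\<alpha> \<in> exponents I e \<Longrightarrow> monom_eval I \<alpha> (\<lambda>i. c * v i) = c ^ e * monom_eval I \<alpha> v"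
  by (auto simp: monom_eval_def exponents_def power_mult_distrib prod.distrib power_sum)

lemma monom_eval_cong: "(\<And>i. i \<in> I \<Longrightarrow> v i = w i) \<Longrightarrow> monom_eval I \<alpha> v = monom_eval I \<alpha> w"
  by (simp add: monom_eval_def)

lemma formsE:
  assumes "F \<in> forms I e"
  obtains c where "F = (\<lambda>v. \<Sum>\<alpha>\<in>exponents I e. c \<alpha> * monom_eval I \<alpha> v)"
  using assms by (auto simp: forms_def)

lemma forms_add: "F \<in> forms I e \<Longrightarrow> G \<in> forms I e \<Longrightarrow> (\<lambda>v. F v + G v) \<in> forms I e"
proof (elim formsE)
  fix c c' assume "F = (\<lambda>v. \<Sum>\<alpha>\<in>exponents I e. c \<alpha> * monom_eval I \<alpha> v)"
    "G = (\<lambda>v. \<Sum>\<alpha>\<in>exponents I e. c' \<alpha> * monom_eval I \<alpha> v)"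
  then have "(\<lambda>v. F v + G v) = (\<lambda>v. \<Sum>\<alpha>\<in>exponents I e. (c \<alpha> + c' \<alpha>) * monom_eval I \<alpha> v)"
    by (simp add: sum.distrib algebra_simps)
  then show ?thesis unfolding forms_def by fast
qed

lemma forms_scale: "F \<in> forms I e \<Longrightarrow> (\<lambda>v. a * F v) \<in> forms I e"
proof (elim formsE)
  fix c assume "F = (\<lambda>v. \<Sum>\<alpha>\<in>exponents I e. c \<alpha> * monom_eval I \<alpha> v)"
  then have "(\<lambda>v. a * F v) = (\<lambda>v. \<Sum>\<alpha>\<in>exponents I e. (a * c \<alpha>) * monom_eval I \<alpha> v)"
    by (simp add: sum_distrib_left mult_ac)
  then show ?thesis unfolding forms_def by fast
qed

lemma forms_zero: "(\<lambda>v. 0) \<in> forms I e"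
  unfolding forms_def by (rule CollectI, rule exI[of _ "\<lambda>_. 0"]) simp

lemma forms_sum: "(\<And>a. a \<in> A \<Longrightarrow> F a \<in> forms I e) \<Longrightarrow> (\<lambda>v. \<Sum>a\<in>A. F a v) \<in> forms I e"
proof (induction A rule: infinite_finite_induct)
  case (insert a A)
  then have "(\<lambda>v. F a v + (\<Sum>b\<in>A. F b v)) \<in> forms I e" by (intro forms_add) simp_all
  then show ?case using insert.hyps by simp
qed (simp_all add: forms_zero)

lemma forms_diff: "F \<in> forms I e \<Longrightarrow> G \<in> forms I e \<Longrightarrow> (\<lambda>v. F v - G v) \<in> forms I e"
  using forms_add[OF _ forms_scale[of G I e "-1"], of F] by simp

lemma forms_monom:
  assumes "finite I" "\<alpha> \<in> exponents I e" shows "monom_eval I \<alpha> \<in> forms I e"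
proof -
  have "monom_eval I \<alpha> = (\<lambda>v. \<Sum>\<beta>\<in>exponents I e. (if \<alpha> = \<beta> then 1 else 0) * monom_eval I \<beta> v)"
    using assms by (auto simp: finite_exponents if_distrib[of "\<lambda>x. x * _"] sum.delta' cong: if_cong)
  then show ?thesis unfolding forms_def by fast
qed

lemma forms_mult:
  assumes I: "finite I" and "F \<in> forms I d" "G \<in> forms I e"
  shows "(\<lambda>v. F v * G v) \<in> forms I (d + e)"
proof -
  obtain c where c: "F = (\<lambda>v. \<Sum>\<alpha>\<in>exponents I d. c \<alpha> * monom_eval I \<alpha> v)"
    using assms(2) by (rule formsE)
  obtain c' where c': "G = (\<lambda>v. \<Sum>\<alpha>\<in>exponents I e. c' \<alpha> * monom_eval I \<alpha> v)"
    using assms(3) by (rule formsE)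
  have "(\<lambda>v. F v * G v) = (\<lambda>v. \<Sum>\<alpha>\<in>exponents I d. \<Sum>\<beta>\<in>exponents I e.
      (c \<alpha> * c' \<beta>) * monom_eval I (\<lambda>i. \<alpha> i + \<beta> i) v)"
    unfolding c c' sum_product monom_eval_add by (intro ext sum.cong refl) (simp add: mult_ac)
  also have "\<dots> \<in> forms I (d + e)"
    by (intro forms_sum forms_scale forms_monom exponents_add I)
  finally show ?thesis .
qed

lemma forms_const: "finite I \<Longrightarrow> (\<lambda>v. a) \<in> forms I 0"
  using forms_scale[OF forms_monom[of I "\<lambda>_. 0" 0], of a] by (simp add: exponents_def monom_eval_def)

lemma forms_coord:
  assumes "finite I" "i \<in> I" shows "(\<lambda>v. v i) \<in> forms I 1"
proof -
  have "monom_eval I (\<lambda>j. if j = i then 1 else 0) = (\<lambda>v. v i)"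
    using assms by (auto simp: monom_eval_def if_distrib[of "\<lambda>x. _ ^ x"] prod.delta cong: if_cong)
  then show ?thesis
    using forms_monom[of I "\<lambda>j. if j = i then 1 else 0" 1] assms by (auto simp: exponents_def)
qed

lemma forms_power: "finite I \<Longrightarrow> F \<in> forms I e \<Longrightarrow> (\<lambda>v. F v ^ k) \<in> forms I (k * e)"
proof (induction k)
  case 0
  then show ?case using forms_const[of I 1] by simp
next
  case (Suc k)
  then show ?case using forms_mult[of I F e "\<lambda>v. F v ^ k" "k * e"] by simp
qed

lemma forms_prod:
  assumes "finite I" "\<And>a. a \<in> A \<Longrightarrow> F a \<in> forms I (e a)"
  shows "(\<lambda>v. \<Prod>a\<in>A. F a v) \<in> forms I (\<Sum>a\<in>A. e a)"
  using assms(2)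
proof (induction A rule: infinite_finite_induct)
  case (insert a A)
  then have "(\<lambda>v. F a v * (\<Prod>b\<in>A. F b v)) \<in> forms I (e a + (\<Sum>b\<in>A. e b))"
    by (intro forms_mult assms(1)) simp_all
  then show ?case using insert.hyps by simp
qed (simp_all add: forms_const assms(1))

lemma forms_homogeneous: "F \<in> forms I e \<Longrightarrow> F (\<lambda>i. c * v i) = c ^ e * F v"
  by (elim formsE) (simp add: monom_eval_scale sum_distrib_left mult_ac)

section \<open>Restriction of forms to lines, and derivatives\<close>

lemma poly_monom_on_line:
  assumes "finite I" "\<alpha> \<in> exponents I e"
  shows "\<exists>p. degree p \<le> e \<and> (\<forall>t. monom_eval I \<alpha> (\<lambda>i. v i + t * w i) = poly p t)"
proof (intro exI conjI allI)
  let ?p = "\<Prod>i\<in>I. [:v i, w i:] ^ \<alpha> i"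
  show "monom_eval I \<alpha> (\<lambda>i. v i + t * w i) = poly ?p t" for t
    by (simp add: monom_eval_def poly_prod)
  have "degree ?p \<le> (\<Sum>i\<in>I. degree ([:v i, w i:] ^ \<alpha> i))"
    using degree_prod_sum_le[OF assms(1)] by (auto simp: o_def)
  also have "\<dots> \<le> (\<Sum>i\<in>I. \<alpha> i)"
  proof (rule sum_mono)
    fix i
    have "degree [:v i, w i:] * \<alpha> i \<le> 1 * \<alpha> i" by (intro mult_right_mono) auto
    then show "degree ([:v i, w i:] ^ \<alpha> i) \<le> \<alpha> i"
      using degree_power_le[of "[:v i, w i:]" "\<alpha> i"] by linarith
  qed
  finally show "degree ?p \<le> e" using assms(2) by (simp add: exponents_def)
qed

lemma poly_form_on_line:
  assumes "finite I" "F \<in> forms I e"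
  obtains p where "degree p \<le> e" "\<And>t. F (\<lambda>i. v i + t * w i) = poly p t"
proof -
  obtain c where c: "F = (\<lambda>v. \<Sum>\<alpha>\<in>exponents I e. c \<alpha> * monom_eval I \<alpha> v)"
    using assms(2) by (rule formsE)
  from poly_monom_on_line[OF assms(1), of _ e v w]
  obtain p where p: "\<And>\<alpha>. \<alpha> \<in> exponents I e \<Longrightarrow> degree (p \<alpha>) \<le> e"
    "\<And>\<alpha> t. \<alpha> \<in> exponents I e \<Longrightarrow> monom_eval I \<alpha> (\<lambda>i. v i + t * w i) = poly (p \<alpha>) t"
    by metis
  show thesis
  proof (rule that)
    show "degree (\<Sum>\<alpha>\<in>exponents I e. smult (c \<alpha>) (p \<alpha>)) \<le> e"
      using p(1) by (intro degree_sum_le finite_exponents assms(1)) (meson degree_smult_le order_trans)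
    show "F (\<lambda>i. v i + t * w i) = poly (\<Sum>\<alpha>\<in>exponents I e. smult (c \<alpha>) (p \<alpha>)) t" for t
      using p(2) by (simp add: c poly_sum)
  qed
qed

text \<open>Product rule for the derivative of a monomial at \<open>v\<close> in direction
  \<open>u\<close>. If \<open>\<alpha> i = 0\<close>, the factor \<open>of_nat (\<alpha> i)\<close>
  kills the term in which \<open>\<alpha> i - 1\<close> is truncated.\<close>

definition dmonom :: "'i set \<Rightarrow> ('i \<Rightarrow> nat) \<Rightarrow> ('i \<Rightarrow> complex) \<Rightarrow> ('i \<Rightarrow> complex) \<Rightarrow> complex" where
  "dmonom I \<alpha> v u = (\<Sum>i\<in>I. of_nat (\<alpha> i) * v i ^ (\<alpha> i - 1) * u i * (\<Prod>j\<in>I-{i}. v j ^ \<alpha> j))"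

lemma dmonom_add: "dmonom I \<alpha> v (\<lambda>i. a * u i + b * w i) = a * dmonom I \<alpha> v u + b * dmonom I \<alpha> v w"
  by (simp add: dmonom_def sum.distrib sum_distrib_left algebra_simps)

lemma has_field_derivative_monom_eval:
  assumes "finite I" "\<And>i. i \<in> I \<Longrightarrow> ((\<lambda>t. y t i) has_field_derivative w i) (at x)"
  shows "((\<lambda>t. monom_eval I \<alpha> (y t)) has_field_derivative dmonom I \<alpha> (y x) w) (at x)"
  unfolding monom_eval_def dmonom_def
proof (rule has_field_derivative_prod)
  fix i assume "i \<in> I"
  from DERIV_power[OF assms(2)[OF this], of "\<alpha> i"]
  show "((\<lambda>t. y t i ^ \<alpha> i) has_field_derivative of_nat (\<alpha> i) * y x i ^ (\<alpha> i - 1) * w i) (at x)"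
    by (simp add: mult_ac)
qed

text \<open>\<open>D\<close> is the differential of \<open>F\<close>. With the chain rule for
  arbitrary curves, one \<open>D\<close> serves both a curve on the Veronese variety and its tangent
  line; linearity in the direction allows subtracting tangent vectors.\<close>

lemma form_derivative:
  fixes F :: "('i \<Rightarrow> complex) \<Rightarrow> complex"
  assumes "finite I" "F \<in> forms I e"
  obtains D where
    "\<forall>(y::complex \<Rightarrow> 'i \<Rightarrow> complex) w x. (\<forall>i\<in>I. ((\<lambda>t. y t i) has_field_derivative w i) (at x)) \<longrightarrow>
       ((\<lambda>t. F (y t)) has_field_derivative D (y x) w) (at x)"
    "\<forall>v a b u w. D v (\<lambda>i. a * u i + b * w i) = a * D v u + b * D v w"
proof -
  obtain c where c: "F = (\<lambda>v. \<Sum>\<alpha>\<in>exponents I e. c \<alpha> * monom_eval I \<alpha> v)"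
    using assms(2) by (rule formsE)
  define D where "D = (\<lambda>v w. \<Sum>\<alpha>\<in>exponents I e. c \<alpha> * dmonom I \<alpha> v w)"
  show thesis
  proof (rule that[of D]; intro allI impI)
    fix y :: "complex \<Rightarrow> 'i \<Rightarrow> complex" and w x
    assume "\<forall>i\<in>I. ((\<lambda>t. y t i) has_field_derivative w i) (at x)"
    then show "((\<lambda>t. F (y t)) has_field_derivative D (y x) w) (at x)"
      unfolding c D_def by (intro DERIV_sum DERIV_cmult has_field_derivative_monom_eval assms(1)) blast
  next
    fix v a b u w
    show "D v (\<lambda>i. a * u i + b * w i) = a * D v u + b * D v w"
      unfolding D_def by (simp add: dmonom_add sum.distrib sum_distrib_left algebra_simps)
  qed
qed

text \<open>Here only the base point varies: for a fixed direction the derivative is a form of one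
  degree less. This drop is why \<open>d\<close> zeros on a line will suffice.\<close>

lemma dmonom_form:
  assumes I: "finite I" and \<alpha>: "\<alpha> \<in> exponents I (Suc e)"
  shows "(\<lambda>v. dmonom I \<alpha> v u) \<in> forms I e"
proof -
  have "(\<lambda>v. of_nat (\<alpha> i) * v i ^ (\<alpha> i - 1) * u i * (\<Prod>j\<in>I-{i}. v j ^ \<alpha> j)) \<in> forms I e"
    if i: "i \<in> I" for i
  proof (cases "\<alpha> i")
    case 0
    then show ?thesis by (simp add: forms_zero)
  next
    case (Suc k)
    let ?\<beta> = "\<alpha>(i := k)"
    have "(\<Sum>j\<in>I. \<alpha> j) = \<alpha> i + (\<Sum>j\<in>I-{i}. \<alpha> j)" "(\<Sum>j\<in>I. ?\<beta> j) = ?\<beta> i + (\<Sum>j\<in>I-{i}. ?\<beta> j)"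
      using I i by (auto simp: sum.remove)
    moreover have "(\<Sum>j\<in>I-{i}. ?\<beta> j) = (\<Sum>j\<in>I-{i}. \<alpha> j)" by (rule sum.cong) auto
    ultimately have \<beta>: "?\<beta> \<in> exponents I e"
      using \<alpha> i Suc by (auto simp: exponents_def)
    have "monom_eval I ?\<beta> v = v i ^ k * (\<Prod>j\<in>I-{i}. v j ^ \<alpha> j)" for v
      using I i by (auto simp: monom_eval_def prod.remove intro!: prod.cong)
    then have eq: "of_nat (\<alpha> i) * v i ^ (\<alpha> i - 1) * u i * (\<Prod>j\<in>I-{i}. v j ^ \<alpha> j) =
        (of_nat (\<alpha> i) * u i) * monom_eval I ?\<beta> v" for v
      unfolding Suc by simp
    show ?thesis unfolding eq by (rule forms_scale[OF forms_monom[OF I \<beta>]])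
  qed
  then show ?thesis unfolding dmonom_def by (rule forms_sum)
qed

section \<open>Tangent spaces of the Veronese variety\<close>

lemma sum_fun_apply: "(\<Sum>i\<in>A. f i) x = (\<Sum>i\<in>A. f i x)"
  by (induction A rule: infinite_finite_induct) auto

text \<open>The hypothesis concerns the family, so a repeated vector already yields a nontrivial
  relation; injectivity then gives the cardinality of the image.\<close>

lemma cvec_independent_image:
  fixes f :: "'a \<Rightarrow> 'i \<Rightarrow> complex"
  assumes fin: "finite I"
    and ind: "\<And>c i. (\<And>x. (\<Sum>i\<in>I. c i * f i x) = 0) \<Longrightarrow> i \<in> I \<Longrightarrow> c i = 0"
  shows "inj_on f I" "cvec.independent (f ` I)"
proof -
  show inj: "inj_on f I"
  proof (rule inj_onI, rule ccontr)
    fix i j assume ij: "i \<in> I" "j \<in> I" "f i = f j" "i \<noteq> j"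
    let ?c = "\<lambda>k. (if k = i then 1 else 0) - (if k = j then 1 else 0) :: complex"
    have "(\<Sum>k\<in>I. ?c k * f k x) = 0" for x
    proof -
      have "(\<Sum>k\<in>I. ?c k * f k x) =
          (\<Sum>k\<in>I. if k = i then f k x else 0) - (\<Sum>k\<in>I. if k = j then f k x else 0)"
        by (simp add: left_diff_distrib sum_subtractf if_distrib[of "\<lambda>y. y * _"] cong: if_cong)
      also have "\<dots> = 0" using ij fin by simp
      finally show ?thesis .
    qed
    from ind[of ?c i, OF this] ij show False by simp
  qed
  show "cvec.independent (f ` I)"
  proof (rule cvec.independent_if_scalars_zero)
    show "finite (f ` I)" using fin by simp
    fix u y assume s: "(\<Sum>x\<in>f ` I. (\<lambda>i. u x * x i)) = 0" and y: "y \<in> f ` I"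
    have "(\<Sum>i\<in>I. u (f i) * f i x) = 0" for x
      using fun_cong[OF s, of x] by (simp add: sum.reindex[OF inj] sum_fun_apply)
    with ind[of "\<lambda>i. u (f i)"] y show "u y = 0" by blast
  qed
qed

lemma vanishes_on_span:
  assumes "F \<in> forms I e" "y \<noteq> 0"
  shows "vanishes_on F {cvec.span {y}} \<longleftrightarrow> F y = 0"
proof
  assume "vanishes_on F {cvec.span {y}}"
  then show "F y = 0" using assms(2) cvec.span_base[of y "{y}"] by (auto simp: vanishes_on_def)
next
  assume "F y = 0"
  then show "vanishes_on F {cvec.span {y}}"
    using forms_homogeneous[OF assms(1)] by (auto simp: vanishes_on_def cvec.span_singleton)
qed

lemma vanishes_on_iff_points: "vanishes_on F X \<longleftrightarrow> (\<forall>p\<in>X. vanishes_on F {p})"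
  by (simp add: vanishes_on_def)

text \<open>Replacing \<open>y\<close> by \<open>c * y\<close> multiplies \<open>F\<close> along the
  line by \<open>c ^ e\<close> and rescales the parameter by \<open>1 / c\<close>, which preserves
  the vanishing of the derivative at 0.\<close>

lemma tangent_space_span:
  assumes y: "y \<noteq> 0"
  shows "tangent_space I X (cvec.span {y}) = {w \<in> coord_space I. \<forall>e. \<forall>F\<in>forms I e.
    vanishes_on F X \<longrightarrow> ((\<lambda>t. F (\<lambda>i. y i + t * w i)) has_field_derivative 0) (at 0)}"
proof -
  have "((\<lambda>t. F (\<lambda>i. v i + t * w i)) has_field_derivative 0) (at 0)"
    if F: "F \<in> forms I e" and D: "((\<lambda>t. F (\<lambda>i. y i + t * w i)) has_field_derivative 0) (at 0)"
      and v: "v \<in> cvec.span {y} - {0}" for e F v w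
  proof -
    obtain c where c: "v = (\<lambda>i. c * y i)" using v by (auto simp: cvec.span_singleton)
    then have "c \<noteq> 0" using v by (auto simp: fun_eq_iff)
    have eq: "F (\<lambda>i. v i + t * w i) = c ^ e * F (\<lambda>i. y i + t / c * w i)" for t
      using forms_homogeneous[OF F, of c "\<lambda>i. y i + t / c * w i"] \<open>c \<noteq> 0\<close>
      by (simp add: c algebra_simps)
    have "((\<lambda>t. F (\<lambda>i. y i + t / c * w i)) has_field_derivative 0 * (1 / c)) (at 0)"
      by (rule DERIV_chain2[of "\<lambda>t. F (\<lambda>i. y i + t * w i)"])
        (use D \<open>c \<noteq> 0\<close> in \<open>auto intro!: derivative_eq_intros\<close>)
    from DERIV_cmult[OF this, of "c ^ e"] show ?thesis by (simp add: eq)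
  qed
  moreover have "y \<in> cvec.span {y} - {0}" using y by (simp add: cvec.span_base)
  ultimately show ?thesis unfolding tangent_space_def by blast
qed

lemma veronese_vec_scale: "veronese_vec n d (\<lambda>i. c * v i) = (\<lambda>\<alpha>. c ^ d * veronese_vec n d v \<alpha>)"
  by (auto simp: veronese_vec_def monom_eval_scale)

lemma veronese_vec_in: "veronese_vec n d v \<in> coord_space (exponents {0..n} d)"
  by (simp add: veronese_vec_def coord_space_def)

lemma veronese_vec_cong: "(\<And>i. i \<le> n \<Longrightarrow> v i = w i) \<Longrightarrow> veronese_vec n d v = veronese_vec n d w"
  using monom_eval_cong[of "{0..n}" v w] by (auto simp: veronese_vec_def)

text \<open>The exponent \<open>(d - 1) e\<^sub>j + e\<^sub>i\<close>.  For fixed \<open>j\<close> these coordinates determine all others near a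
  point with \<open>v j \<noteq> 0\<close>, and they are affine coordinates of the projective space there.\<close>

definition star_exponent :: "nat \<Rightarrow> nat \<Rightarrow> nat \<Rightarrow> nat \<Rightarrow> nat" where
  "star_exponent d j i = (\<lambda>k. (if k = j then d - 1 else 0) + (if k = i then 1 else 0))"

lemma star_exponent_in:
  "d \<ge> 1 \<Longrightarrow> i \<le> n \<Longrightarrow> j \<le> n \<Longrightarrow> star_exponent d j i \<in> exponents {0..n} d"
  by (auto simp: star_exponent_def exponents_def sum.distrib)

lemma monom_eval_star_exponent:
  assumes "i \<le> n" "j \<le> n"
  shows "monom_eval {0..n} (star_exponent d j i) v = v j ^ (d - 1) * v i"
proof -
  have "monom_eval {0..n} (\<lambda>k. if k = j then m else 0) v = v j ^ m" if "j \<le> n" for j m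
    using that by (simp add: monom_eval_def if_distrib[of "\<lambda>m. _ ^ m"] prod.delta cong: if_cong)
  then show ?thesis using assms unfolding star_exponent_def monom_eval_add by simp
qed

lemma veronese_vec_star:
  "d \<ge> 1 \<Longrightarrow> i \<le> n \<Longrightarrow> j \<le> n \<Longrightarrow> veronese_vec n d v (star_exponent d j i) = v j ^ (d - 1) * v i"
  by (simp add: veronese_vec_def star_exponent_in monom_eval_star_exponent)

lemma veronese_vec_nonzero:
  assumes "v \<in> coord_space {0..n}" "v \<noteq> 0" "d \<ge> 1"
  shows "veronese_vec n d v \<noteq> 0"
proof -
  obtain j where j: "v j \<noteq> 0" using assms(2) by (auto simp: fun_eq_iff)
  with assms(1) have "j \<le> n" by (auto simp: coord_space_def)
  with j veronese_vec_star[of d j n j v] assms(3) show ?thesis by auto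
qed

lemma veronese_map_span: "veronese_map n d (cvec.span {v}) = cvec.span {veronese_vec n d v}"
proof -
  have "veronese_vec n d ` cvec.span {v} \<subseteq> cvec.span {veronese_vec n d v}"
    by (auto simp: cvec.span_singleton veronese_vec_scale)
  moreover have "veronese_vec n d v \<in> cvec.span (veronese_vec n d ` cvec.span {v})"
    by (intro cvec.span_base imageI) (simp add: cvec.span_base)
  ultimately show ?thesis
    unfolding veronese_map_def by (simp add: cvec.span_eq)
qed

lemma veronese_variety_eq:
  "veronese_variety n d = {cvec.span {veronese_vec n d v} | v. v \<in> coord_space {0..n} \<and> v \<noteq> 0}"
  unfolding veronese_variety_def proj_space_def
  by (auto simp: veronese_map_span image_iff) (metis veronese_map_span)

lemma veronese_variety_subset:
  "d \<ge> 1 \<Longrightarrow> veronese_variety n d \<subseteq> proj_space (exponents {0..n} d)"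
  using veronese_vec_nonzero veronese_vec_in unfolding veronese_variety_eq proj_space_def by blast

text \<open>Dropping the restrictions to nonzero vectors and to vectors supported in
  \<open>{0..n}\<close> gives an identity in all \<open>x\<close>, which can be differentiated along
  any line.\<close>

lemma form_vanishes_on_veronese_variety:
  assumes d: "d \<ge> 1" and F: "F \<in> forms (exponents {0..n} d) e"
  shows "vanishes_on F (veronese_variety n d) \<longleftrightarrow> (\<forall>x. F (veronese_vec n d x) = 0)"
proof -
  have nz: "vanishes_on F {cvec.span {veronese_vec n d v}} \<longleftrightarrow> F (veronese_vec n d v) = 0"
    if "v \<in> coord_space {0..n}" "v \<noteq> 0" for v
    using vanishes_on_span[OF F] veronese_vec_nonzero[OF that d] .
  have "F (veronese_vec n d x) = 0" if V: "vanishes_on F (veronese_variety n d)" for x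
  proof -
    define x' where "x' = (\<lambda>i. if i \<le> n then x i else 0)"
    have eq: "veronese_vec n d x = veronese_vec n d x'"
      by (rule veronese_vec_cong) (simp add: x'_def)
    have *: "F (veronese_vec n d v) = 0" if "v \<in> coord_space {0..n}" "v \<noteq> 0" for v
      using V nz[OF that] that by (subst (asm) vanishes_on_iff_points) (auto simp: veronese_variety_eq)
    show ?thesis
    proof (cases "x' = 0")
      case True
      \<comment> \<open>The zero vector is reached by scaling some admissible \<open>v\<close> by 0.
        As \<open>F\<close> already vanishes at the image of \<open>v\<close>, this covers
        \<open>e = 0\<close> too, where the factor produced by homogeneity is 1.\<close>
      define v where "v = (\<lambda>i::nat. if i = 0 then 1 else 0 :: complex)"
      have "v \<in> coord_space {0..n}" "v \<noteq> 0" by (auto simp: v_def coord_space_def fun_eq_iff)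
      from *[OF this] have "F (\<lambda>\<alpha>. 0 ^ d * veronese_vec n d v \<alpha>) = 0"
        by (simp only: forms_homogeneous[OF F]) simp
      moreover have "x' = (\<lambda>i. 0 * v i)" using True by (auto simp: fun_eq_iff)
      ultimately show ?thesis unfolding eq by (simp only: veronese_vec_scale)
    next
      case False
      show ?thesis unfolding eq by (rule *) (use False in \<open>auto simp: x'_def coord_space_def\<close>)
    qed
  qed
  moreover have "vanishes_on F (veronese_variety n d)" if "\<forall>x. F (veronese_vec n d x) = 0"
    using that nz by (subst vanishes_on_iff_points) (auto simp: veronese_variety_eq)
  ultimately show ?thesis by blast
qed

definition veronese_deriv ::
    "nat \<Rightarrow> nat \<Rightarrow> (nat \<Rightarrow> complex) \<Rightarrow> (nat \<Rightarrow> complex) \<Rightarrow> (nat \<Rightarrow> nat) \<Rightarrow> complex" where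
  "veronese_deriv n d v u = (\<lambda>\<alpha>. if \<alpha> \<in> exponents {0..n} d then dmonom {0..n} \<alpha> v u else 0)"

lemma has_field_derivative_veronese_vec:
  "((\<lambda>t. veronese_vec n d (\<lambda>i. v i + t * u i) \<alpha>) has_field_derivative veronese_deriv n d v u \<alpha>) (at 0)"
proof (cases "\<alpha> \<in> exponents {0..n} d")
  case True
  have "((\<lambda>t. monom_eval {0..n} \<alpha> (\<lambda>i. v i + t * u i)) has_field_derivative
      dmonom {0..n} \<alpha> (\<lambda>i. v i + 0 * u i) u) (at 0)"
    by (rule has_field_derivative_monom_eval) (auto intro!: derivative_eq_intros)
  with True show ?thesis by (simp add: veronese_vec_def veronese_deriv_def)
qed (simp add: veronese_vec_def veronese_deriv_def)

lemma veronese_deriv_sum: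
  "veronese_deriv n d v u \<alpha> = (\<Sum>i=0..n. u i * veronese_deriv n d v (\<lambda>k. if k = i then 1 else 0) \<alpha>)"
proof (cases "\<alpha> \<in> exponents {0..n} d")
  case True
  have "dmonom {0..n} \<alpha> v u = (\<Sum>i=0..n. u i * dmonom {0..n} \<alpha> v (\<lambda>k. if k = i then 1 else 0))"
    unfolding dmonom_def
    by (rule sum.cong)
      (auto simp: if_distrib[of "\<lambda>x. _ * x"] if_distrib[of "\<lambda>x. x * _"] mult_ac cong: if_cong)
  with True show ?thesis by (simp add: veronese_deriv_def)
qed (simp add: veronese_deriv_def)

lemma veronese_deriv_in: "veronese_deriv n d v u \<in> coord_space (exponents {0..n} d)"
  by (simp add: veronese_deriv_def coord_space_def)

lemma veronese_deriv_star:
  assumes "d \<ge> 2" "i \<le> n" "j \<le> n"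
  shows "veronese_deriv n d v u (star_exponent d j i) =
    of_nat (d - 1) * v j ^ (d - 2) * u j * v i + v j ^ (d - 1) * u i"
proof (rule DERIV_unique)
  show "((\<lambda>t. veronese_vec n d (\<lambda>i. v i + t * u i) (star_exponent d j i)) has_field_derivative
      veronese_deriv n d v u (star_exponent d j i)) (at 0)"
    by (rule has_field_derivative_veronese_vec)
  have "((\<lambda>t. (v j + t * u j) ^ (d - 1) * (v i + t * u i)) has_field_derivative
      of_nat (d - 1) * v j ^ (d - 1 - Suc 0) * u j * v i + v j ^ (d - 1) * u i) (at 0)"
    by (auto intro!: derivative_eq_intros)
  moreover have "d - 1 - Suc 0 = d - 2" by simp
  ultimately have "((\<lambda>t. (v j + t * u j) ^ (d - 1) * (v i + t * u i)) has_field_derivative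
      of_nat (d - 1) * v j ^ (d - 2) * u j * v i + v j ^ (d - 1) * u i) (at 0)" by metis
  then show "((\<lambda>t. veronese_vec n d (\<lambda>i. v i + t * u i) (star_exponent d j i)) has_field_derivative
      of_nat (d - 1) * v j ^ (d - 2) * u j * v i + v j ^ (d - 1) * u i) (at 0)"
    using assms by (simp add: veronese_vec_star)
qed

text \<open>The system is triangular: the equation for \<open>i = j\<close> reads
  \<open>of_nat d * v j ^ (d - 1) * u j = w j\<close> and fixes \<open>u j\<close> (the value
  \<open>a\<close> below); every other equation is then solved for its \<open>u i\<close>.\<close>

lemma veronese_deriv_star_solvable:
  assumes "d \<ge> 2" "j \<le> n" "v j \<noteq> (0::complex)"
  obtains u where "\<And>i. i \<le> n \<Longrightarrow> veronese_deriv n d v u (star_exponent d j i) = w i"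
proof
  obtain k where k: "d = Suc (Suc k)" using assms(1) by (intro that[of "d - 2"]) simp
  define a where "a = w j / (of_nat d * v j ^ (d - 1))"
  define u where "u = (\<lambda>i. (w i - of_nat (d - 1) * v j ^ (d - 2) * a * v i) / v j ^ (d - 1))"
  have "w j = of_nat (Suc (Suc k)) * v j ^ Suc k * a"
    using assms(3) by (simp add: a_def k del: of_nat_Suc)
  then have "u j = (of_nat (Suc (Suc k)) * v j ^ Suc k * a - of_nat (Suc k) * v j ^ Suc k * a) / v j ^ Suc k"
    by (simp add: u_def k mult_ac)
  also have "\<dots> = a" using assms(3) by (simp add: field_simps)
  finally have "u j = a" .
  then show "veronese_deriv n d v u (star_exponent d j i) = w i" if "i \<le> n" for i
    using assms that by (simp add: veronese_deriv_star) (simp add: u_def)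
qed

text \<open>The same triangular system with right-hand side 0. Characteristic 0 enters through the
  coefficient \<open>of_nat (d - 1) + 1\<close> of the equation for \<open>i = j\<close>.\<close>

lemma veronese_deriv_star_inj:
  assumes "d \<ge> 2" "j \<le> n" "v j \<noteq> (0::complex)"
    and "\<And>i. i \<le> n \<Longrightarrow> veronese_deriv n d v u (star_exponent d j i) = 0" and "i \<le> n"
  shows "u i = 0"
proof -
  obtain k where k: "d = Suc (Suc k)" using assms(1) by (intro that[of "d - 2"]) simp
  have "(of_nat (d - 1) + 1) * (v j ^ (d - 1) * u j) = 0"
    using assms(4)[of j] assms(1,2) by (simp add: veronese_deriv_star k algebra_simps)
  moreover have "(of_nat (d - 1) + 1 :: complex) \<noteq> 0"
    by (metis of_nat_Suc of_nat_neq_0 add.commute)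
  ultimately have "u j = 0" using assms(3) by simp
  then show ?thesis using assms(4)[of i] assms by (simp add: veronese_deriv_star)
qed

lemma dim_veronese_deriv:
  assumes "d \<ge> 2" "j \<le> n" "v j \<noteq> 0"
  shows "cvec.dim (range (veronese_deriv n d v)) = n + 1"
proof -
  define b where "b = (\<lambda>i. veronese_deriv n d v (\<lambda>k. if k = i then 1 else 0))"
  have s: "veronese_deriv n d v u \<alpha> = (\<Sum>i=0..n. u i * b i \<alpha>)" for u \<alpha>
    unfolding b_def by (rule veronese_deriv_sum)
  have ind: "u i = 0" if "\<And>\<alpha>. (\<Sum>i\<in>{0..n}. u i * b i \<alpha>) = 0" "i \<in> {0..n}" for u i
    using veronese_deriv_star_inj[where v = v and u = u and i = i, OF assms] that by (simp add: s)
  show ?thesis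
  proof (rule cvec.dim_unique)
    show "b ` {0..n} \<subseteq> range (veronese_deriv n d v)" by (auto simp: b_def)
    show "cvec.independent (b ` {0..n})"
      by (rule cvec_independent_image(2)) (use ind in blast)+
    have "inj_on b {0..n}" by (rule cvec_independent_image(1)) (use ind in blast)+
    then show "card (b ` {0..n}) = n + 1" by (simp add: card_image)
    have "veronese_deriv n d v u \<in> cvec.span (b ` {0..n})" for u
    proof -
      have "veronese_deriv n d v u = (\<Sum>i\<in>{0..n}. (\<lambda>\<alpha>. u i * b i \<alpha>))"
        by (rule ext) (simp add: s sum_fun_apply)
      also have "\<dots> \<in> cvec.span (b ` {0..n})"
        by (intro cvec.span_sum cvec.span_scale cvec.span_base imageI)
      finally show ?thesis .
    qed
    then show "range (veronese_deriv n d v) \<subseteq> cvec.span (b ` {0..n})" by auto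
  qed
qed

text \<open>One inclusion differentiates the vanishing of \<open>F\<close> along the curve of images
  of \<open>v + t u\<close>. For the other, the derivative vector with the same star coordinates as
  \<open>w\<close> is subtracted, and for each remaining coordinate a binomial in the ideal forces
  the difference to vanish there.\<close>

lemma tangent_space_veronese:
  assumes d: "d \<ge> 2" and v: "v \<in> coord_space {0..n}" "v \<noteq> 0"
  shows "tangent_space (exponents {0..n} d) (veronese_variety n d) (cvec.span {veronese_vec n d v}) =
    range (veronese_deriv n d v)"
proof -
  let ?E = "exponents {0..n} d" and ?X = "veronese_variety n d" and ?y = "veronese_vec n d v"
  have d1: "d \<ge> 1" using d by simp
  have E: "finite ?E" by (simp add: finite_exponents)
  have T: "tangent_space ?E ?X (cvec.span {?y}) = {w \<in> coord_space ?E. \<forall>e. \<forall>F\<in>forms ?E e.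
    vanishes_on F ?X \<longrightarrow> ((\<lambda>t. F (\<lambda>i. ?y i + t * w i)) has_field_derivative 0) (at 0)}"
    by (rule tangent_space_span[OF veronese_vec_nonzero[OF v d1]])
  have line: "((\<lambda>t. y i + t * w i) has_field_derivative w i) (at 0)" for y w :: "_ \<Rightarrow> complex" and i
    by (auto intro!: derivative_eq_intros)
  have tan: "veronese_deriv n d v u \<in> tangent_space ?E ?X (cvec.span {?y})" for u
    unfolding T
  proof (intro CollectI conjI allI ballI impI veronese_deriv_in)
    fix e F assume F: "F \<in> forms ?E e" and van: "vanishes_on F ?X"
    obtain D where D: "\<forall>(y::complex \<Rightarrow> _) w x.
        (\<forall>i\<in>?E. ((\<lambda>t. y t i) has_field_derivative w i) (at x)) \<longrightarrow>
        ((\<lambda>t. F (y t)) has_field_derivative D (y x) w) (at x)"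
      by (rule form_derivative[OF E F]) (rule that)
    have "((\<lambda>t. F (veronese_vec n d (\<lambda>i. v i + t * u i))) has_field_derivative
        D (veronese_vec n d (\<lambda>i. v i + 0 * u i)) (veronese_deriv n d v u)) (at 0)"
      by (rule D[rule_format, of "\<lambda>t. veronese_vec n d (\<lambda>i. v i + t * u i)"])
        (rule has_field_derivative_veronese_vec)
    moreover have "((\<lambda>t. F (veronese_vec n d (\<lambda>i. v i + t * u i))) has_field_derivative 0) (at 0)"
      using van form_vanishes_on_veronese_variety[OF d1 F] by simp
    ultimately have "D ?y (veronese_deriv n d v u) = 0" by (auto dest: DERIV_unique)
    moreover have "((\<lambda>t. F (\<lambda>i. ?y i + t * veronese_deriv n d v u i)) has_field_derivative
        D (\<lambda>i. ?y i + 0 * veronese_deriv n d v u i) (veronese_deriv n d v u)) (at 0)"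
      by (rule D[rule_format, of "\<lambda>t i. ?y i + t * veronese_deriv n d v u i"]) (rule line)
    ultimately show "((\<lambda>t. F (\<lambda>i. ?y i + t * veronese_deriv n d v u i)) has_field_derivative 0) (at 0)"
      by simp
  qed
  obtain j where j: "v j \<noteq> 0" using v(2) by (auto simp: fun_eq_iff)
  then have jn: "j \<le> n" using v(1) by (auto simp: coord_space_def)
  have "w \<in> range (veronese_deriv n d v)" if w: "w \<in> tangent_space ?E ?X (cvec.span {?y})" for w
  proof -
    obtain u where u: "\<And>i. i \<le> n \<Longrightarrow>
        veronese_deriv n d v u (star_exponent d j i) = w (star_exponent d j i)"
      using veronese_deriv_star_solvable[where v = v and w = "\<lambda>i. w (star_exponent d j i)", OF d jn j] by blast
    define w' where "w' = (\<lambda>\<alpha>. 1 * w \<alpha> + (-1) * veronese_deriv n d v u \<alpha>)"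
    have w'_star: "w' (star_exponent d j i) = 0" if "i \<le> n" for i using u[OF that] by (simp add: w'_def)
    have w': "((\<lambda>t. F (\<lambda>i. ?y i + t * w' i)) has_field_derivative 0) (at 0)"
      if F: "F \<in> forms ?E e" and van: "vanishes_on F ?X" for e F
    proof -
      obtain D where D: "\<forall>(y::complex \<Rightarrow> _) w x.
          (\<forall>i\<in>?E. ((\<lambda>t. y t i) has_field_derivative w i) (at x)) \<longrightarrow>
          ((\<lambda>t. F (y t)) has_field_derivative D (y x) w) (at x)"
        and D_lin: "\<forall>v a b u w. D v (\<lambda>i. a * u i + b * w i) = a * D v u + b * D v w"
        by (rule form_derivative[OF E F]) (rule that)
      have "((\<lambda>t. F (\<lambda>i. ?y i + t * x i)) has_field_derivative D (\<lambda>i. ?y i + 0 * x i) x) (at 0)" for x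
        by (rule D[rule_format, of "\<lambda>t i. ?y i + t * x i"]) (rule line)
      then have D0: "((\<lambda>t. F (\<lambda>i. ?y i + t * x i)) has_field_derivative D ?y x) (at 0)" for x
        by simp
      have "D ?y x = 0" if "x \<in> tangent_space ?E ?X (cvec.span {?y})" for x
        using that F van D0[of x] unfolding T by (auto dest: DERIV_unique)
      then have "D ?y w' = 0" using w tan unfolding w'_def D_lin[rule_format] by simp
      with D0[of w'] show ?thesis by simp
    qed
    have "w' \<alpha> = 0" if \<alpha>: "\<alpha> \<in> ?E" for \<alpha>
    proof (cases "\<exists>i\<le>n. \<alpha> = star_exponent d j i")
      case True
      then show ?thesis using w'_star by blast
    next
      case False
      let ?s = "star_exponent d j"
      \<comment> \<open>At the image of \<open>x\<close> both terms equal
        \<open>x j ^ (d * (d - 1))\<close> times the monomial of \<open>\<alpha>\<close>. The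
        degrees agree because the entries of \<open>\<alpha>\<close> add up to
        \<open>d\<close>.\<close>
      define P :: "((nat \<Rightarrow> nat) \<Rightarrow> complex) \<Rightarrow> complex"
        where "P = (\<lambda>y. y \<alpha> * y (?s j) ^ (d - 1) - (\<Prod>i=0..n. y (?s i) ^ \<alpha> i))"
      have s: "?s i \<in> ?E" if "i \<le> n" for i using star_exponent_in[OF d1 that jn] .
      have "(\<lambda>y. y \<alpha> * y (?s j) ^ (d - 1)) \<in> forms ?E (1 + (d - 1) * 1)"
        by (intro forms_mult forms_power forms_coord E \<alpha> s jn)
      moreover have "(\<lambda>y. \<Prod>i=0..n. y (?s i) ^ \<alpha> i) \<in> forms ?E (\<Sum>i=0..n. \<alpha> i * 1)"
        by (intro forms_prod forms_power forms_coord E s) simp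
      ultimately have P: "P \<in> forms ?E d"
        unfolding P_def using d \<alpha> by (intro forms_diff) (auto simp: exponents_def)
      have "P (veronese_vec n d x) = 0" for x
      proof -
        have "(\<Prod>i=0..n. veronese_vec n d x (?s i) ^ \<alpha> i) = (\<Prod>i=0..n. (x j ^ (d - 1)) ^ \<alpha> i * x i ^ \<alpha> i)"
          by (rule prod.cong) (auto simp: veronese_vec_star[OF d1 _ jn] power_mult_distrib)
        also have "\<dots> = (x j ^ (d - 1)) ^ d * monom_eval {0..n} \<alpha> x"
          using \<alpha> by (simp add: prod.distrib monom_eval_def exponents_def flip: power_sum)
        also have "(x j ^ (d - 1)) ^ d = (x j ^ (d - 1) * x j) ^ (d - 1)"
          using d by (cases d) (simp_all add: power_mult_distrib mult.commute flip: power_mult)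
        finally show ?thesis
          using veronese_vec_star[OF d1 jn jn, of x] \<alpha> by (simp add: P_def veronese_vec_def)
      qed
      then have "vanishes_on P ?X" using form_vanishes_on_veronese_variety[OF d1 P] by simp
      from w'[OF P this] have D0: "((\<lambda>t. P (\<lambda>i. ?y i + t * w' i)) has_field_derivative 0) (at 0)" .
      \<comment> \<open>All star coordinates of \<open>w'\<close> are 0, so only the factor at
        \<open>\<alpha>\<close> moves along this line: \<open>P\<close> is affine in
        \<open>t\<close>, and its slope is \<open>w' \<alpha>\<close> times a nonzero
        number.\<close>
      have "P (\<lambda>i. ?y i + t * w' i) = (?y \<alpha> + t * w' \<alpha>) * ?y (?s j) ^ (d - 1) -
          (\<Prod>i=0..n. ?y (?s i) ^ \<alpha> i)" for t
        using w'_star jn by (simp add: P_def)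
      with D0 have "((\<lambda>t. (?y \<alpha> + t * w' \<alpha>) * ?y (?s j) ^ (d - 1) -
          (\<Prod>i=0..n. ?y (?s i) ^ \<alpha> i)) has_field_derivative 0) (at 0)" by simp
      moreover have "((\<lambda>t. (?y \<alpha> + t * w' \<alpha>) * ?y (?s j) ^ (d - 1) -
          (\<Prod>i=0..n. ?y (?s i) ^ \<alpha> i)) has_field_derivative w' \<alpha> * ?y (?s j) ^ (d - 1)) (at 0)"
        by (auto intro!: derivative_eq_intros)
      ultimately have "w' \<alpha> * ?y (?s j) ^ (d - 1) = 0" by (auto dest: DERIV_unique)
      then show ?thesis using j by (simp add: veronese_vec_star[OF d1 jn jn])
    qed
    moreover have "w \<in> coord_space ?E" using w by (simp add: tangent_space_def)
    ultimately have "w = veronese_deriv n d v u"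
      using veronese_deriv_in[of n d v u]
      by (intro ext, case_tac "x \<in> ?E") (auto simp: w'_def coord_space_def)
    then show ?thesis by blast
  qed
  with tan show ?thesis by auto
qed

section \<open>Zariski topology\<close>

lemma proj_spaceE:
  assumes "p \<in> proj_space I"
  obtains v where "v \<in> coord_space I" "v \<noteq> 0" "p = cvec.span {v}"
  using assms by (auto simp: proj_space_def)

lemma vanishes_on_point_mult:
  assumes I: "finite I" and F: "F \<in> forms I d" and G: "G \<in> forms I e" and p: "p \<in> proj_space I"
  shows "vanishes_on (\<lambda>v. F v * G v) {p} \<longleftrightarrow> vanishes_on F {p} \<or> vanishes_on G {p}"
proof -
  obtain v where v: "v \<noteq> 0" "p = cvec.span {v}" using p by (rule proj_spaceE)
  show ?thesis
    unfolding v(2) vanishes_on_span[OF forms_mult[OF I F G] v(1)]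
      vanishes_on_span[OF F v(1)] vanishes_on_span[OF G v(1)] by simp
qed

lemma vanishes_on_one:
  assumes "p \<in> proj_space I" shows "\<not> vanishes_on (\<lambda>v. 1) {p}"
proof -
  obtain v where v: "v \<noteq> 0" "p = cvec.span {v}" using assms by (rule proj_spaceE)
  then have "v \<in> p - {0}" by (simp add: cvec.span_base)
  then show ?thesis by (auto simp: vanishes_on_def)
qed

lemma topspace_zariski:
  assumes "finite I" shows "topspace (zariski I) = proj_space I"
proof -
  have "proj_space I \<subseteq> {p \<in> proj_space I. \<not> vanishes_on (\<lambda>v. 1) {p}}"
    using vanishes_on_one by blast
  with forms_const[OF assms, of 1] show ?thesis
    unfolding zariski_def topology_generated_by_topspace by blast
qed

text \<open>The nonvanishing loci of \<open>F\<close> and \<open>G\<close> meet in that of their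
  product, so the generating sets form a basis and not only a subbasis.\<close>

lemma openin_zariski:
  assumes I: "finite I"
  shows "openin (zariski I) U \<longleftrightarrow> U \<subseteq> proj_space I \<and> (\<forall>p\<in>U. \<exists>e. \<exists>F\<in>forms I e.
    \<not> vanishes_on F {p} \<and> {q \<in> proj_space I. \<not> vanishes_on F {q}} \<subseteq> U)" (is "_ \<longleftrightarrow> ?rhs U")
proof
  assume "openin (zariski I) U"
  then have "generate_topology_on {{p \<in> proj_space I. \<not> vanishes_on F {p}} | F. \<exists>e. F \<in> forms I e} U"
    by (simp add: zariski_def openin_topology_generated_by_iff)
  then show "?rhs U"
  proof induction
    case (Int A B)
    show ?case
    proof (intro conjI ballI)
      fix p assume p: "p \<in> A \<inter> B"
      obtain d F where F: "F \<in> forms I d" "\<not> vanishes_on F {p}"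
        "{q \<in> proj_space I. \<not> vanishes_on F {q}} \<subseteq> A" using Int.IH(1) p by blast
      obtain e G where G: "G \<in> forms I e" "\<not> vanishes_on G {p}"
        "{q \<in> proj_space I. \<not> vanishes_on G {q}} \<subseteq> B" using Int.IH(2) p by blast
      note m = vanishes_on_point_mult[OF I F(1) G(1)]
      have "\<not> vanishes_on (\<lambda>v. F v * G v) {p}" using m[of p] p F(2) G(2) Int.IH(1) by blast
      moreover have "{q \<in> proj_space I. \<not> vanishes_on (\<lambda>v. F v * G v) {q}} \<subseteq> A \<inter> B"
        using m F(3) G(3) by blast
      ultimately show "\<exists>e. \<exists>F\<in>forms I e. \<not> vanishes_on F {p} \<and>
          {q \<in> proj_space I. \<not> vanishes_on F {q}} \<subseteq> A \<inter> B"
        using forms_mult[OF I F(1) G(1)] by blast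
    qed (use Int.IH in blast)
  next
    case (UN K)
    show ?case
    proof (intro conjI ballI)
      show "\<Union>K \<subseteq> proj_space I" using UN.IH by blast
      fix p assume "p \<in> \<Union>K"
      then obtain A where A: "A \<in> K" "p \<in> A" by blast
      obtain e F where "F \<in> forms I e" "\<not> vanishes_on F {p}"
        "{q \<in> proj_space I. \<not> vanishes_on F {q}} \<subseteq> A" using UN.IH[OF A(1)] A(2) by blast
      then show "\<exists>e. \<exists>F\<in>forms I e. \<not> vanishes_on F {p} \<and>
          {q \<in> proj_space I. \<not> vanishes_on F {q}} \<subseteq> \<Union>K" using A(1) by blast
    qed
  qed blast+
next
  assume U: "?rhs U"
  show "openin (zariski I) U"
  proof (subst openin_subopen, intro ballI)
    fix p assume p: "p \<in> U"
    then obtain e F where F: "F \<in> forms I e" "\<not> vanishes_on F {p}"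
      "{q \<in> proj_space I. \<not> vanishes_on F {q}} \<subseteq> U" using U by blast
    have "openin (zariski I) {q \<in> proj_space I. \<not> vanishes_on F {q}}"
      unfolding zariski_def by (rule topology_generated_by_Basis) (use F(1) in blast)
    then show "\<exists>T. openin (zariski I) T \<and> p \<in> T \<and> T \<subseteq> U" using F p U by blast
  qed
qed

lemma closedin_subtopology_zariski:
  assumes I: "finite I" and S: "S \<subseteq> proj_space I"
  shows "closedin (subtopology (zariski I) S) C \<longleftrightarrow> C \<subseteq> S \<and>
    (\<forall>p\<in>S - C. \<exists>e. \<exists>F\<in>forms I e. vanishes_on F C \<and> \<not> vanishes_on F {p})"
proof -
  have top: "topspace (subtopology (zariski I) S) = S"
    using S by (auto simp: topspace_zariski[OF I])
  show ?thesis
  proof (intro iffI conjI ballI)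
    assume C: "closedin (subtopology (zariski I) S) C"
    then show CS: "C \<subseteq> S" using closedin_subset top by metis
    obtain T where T: "openin (zariski I) T" "S - C = T \<inter> S"
      using C unfolding closedin_def top openin_subtopology by blast
    fix p assume p: "p \<in> S - C"
    then obtain e F where F: "F \<in> forms I e" "\<not> vanishes_on F {p}"
      "{q \<in> proj_space I. \<not> vanishes_on F {q}} \<subseteq> T"
      using T openin_zariski[OF I] by blast
    have "vanishes_on F C"
      using F(3) T(2) CS S by (subst vanishes_on_iff_points) blast
    with F show "\<exists>e. \<exists>F\<in>forms I e. vanishes_on F C \<and> \<not> vanishes_on F {p}" by blast
  next
    assume C: "C \<subseteq> S \<and> (\<forall>p\<in>S - C. \<exists>e. \<exists>F\<in>forms I e. vanishes_on F C \<and> \<not> vanishes_on F {p})"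
    define T where
      "T = \<Union>{{q \<in> proj_space I. \<not> vanishes_on F {q}} | F. (\<exists>e. F \<in> forms I e) \<and> vanishes_on F C}"
    have "openin (zariski I) T"
      unfolding T_def zariski_def by (intro openin_Union) (auto intro!: topology_generated_by_Basis)
    moreover have "S - C = T \<inter> S"
    proof
      show "S - C \<subseteq> T \<inter> S" unfolding T_def using C S by blast
      have "q \<notin> C" if "vanishes_on F C" "\<not> vanishes_on F {q}" for F q
        using that vanishes_on_iff_points[of F C] by blast
      then show "T \<inter> S \<subseteq> S - C" unfolding T_def by blast
    qed
    ultimately show "closedin (subtopology (zariski I) S) C"
      using C unfolding closedin_def top openin_subtopology by blast
  qed
qed

text \<open>The zero loci of \<open>F\<close> and \<open>G\<close> in \<open>S\<close> are closed
  and cover \<open>Z\<close>; irreducibility thus acts as primality of the homogeneous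
  ideal.\<close>

lemma irreducible_in_vanishes_on_mult:
  assumes I: "finite I" and S: "S \<subseteq> proj_space I" and Z: "irreducible_in (subtopology (zariski I) S) Z"
    and F: "F \<in> forms I d" and G: "G \<in> forms I e" and FG: "vanishes_on (\<lambda>v. F v * G v) Z"
  shows "vanishes_on F Z \<or> vanishes_on G Z"
proof -
  have ZS: "Z \<subseteq> S"
    using Z S by (auto simp: irreducible_in_def topspace_zariski[OF I])
  have closed: "closedin (subtopology (zariski I) S) {p \<in> S. vanishes_on F {p}}"
    if "F \<in> forms I e" for F e
  proof -
    have "vanishes_on F {p \<in> S. vanishes_on F {p}}" by (subst vanishes_on_iff_points) blast
    with that show ?thesis unfolding closedin_subtopology_zariski[OF I S] by blast
  qed
  have "Z \<subseteq> {p \<in> S. vanishes_on F {p}} \<union> {p \<in> S. vanishes_on G {p}}"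
    using FG ZS S vanishes_on_point_mult[OF I F G] vanishes_on_iff_points[of "\<lambda>v. F v * G v" Z] by blast
  then have "Z \<subseteq> {p \<in> S. vanishes_on F {p}} \<or> Z \<subseteq> {p \<in> S. vanishes_on G {p}}"
    using Z closed[OF F] closed[OF G] unfolding irreducible_in_def by blast
  then show ?thesis
    using vanishes_on_iff_points[of F Z] vanishes_on_iff_points[of G Z] by blast
qed

text \<open>Conversely, if \<open>Z\<close> escaped both \<open>C\<close> and \<open>D\<close>,
  forms vanishing on \<open>C\<close> and on \<open>D\<close>, but not at the escaping points, would
  have a product vanishing on \<open>Z\<close>.\<close>

lemma irreducible_in_subtopology_zariskiI:
  assumes I: "finite I" and S: "S \<subseteq> proj_space I" and Z: "Z \<noteq> {}" "Z \<subseteq> S"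
    and prime: "\<And>d e F G. F \<in> forms I d \<Longrightarrow> G \<in> forms I e \<Longrightarrow> vanishes_on (\<lambda>v. F v * G v) Z \<Longrightarrow>
      vanishes_on F Z \<or> vanishes_on G Z"
  shows "irreducible_in (subtopology (zariski I) S) Z"
  unfolding irreducible_in_def
proof (intro conjI allI impI)
  show "Z \<noteq> {}" by fact
  show "Z \<subseteq> topspace (subtopology (zariski I) S)" using Z S by (auto simp: topspace_zariski[OF I])
  fix C D assume CD: "closedin (subtopology (zariski I) S) C \<and>
    closedin (subtopology (zariski I) S) D \<and> Z \<subseteq> C \<union> D"
  show "Z \<subseteq> C \<or> Z \<subseteq> D"
  proof (rule ccontr)
    assume "\<not> (Z \<subseteq> C \<or> Z \<subseteq> D)"
    then obtain p q where pq: "p \<in> Z" "p \<notin> C" "q \<in> Z" "q \<notin> D" by blast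
    obtain d F where F: "F \<in> forms I d" "vanishes_on F C" "\<not> vanishes_on F {p}"
      using CD pq Z unfolding closedin_subtopology_zariski[OF I S] by blast
    obtain e G where G: "G \<in> forms I e" "vanishes_on G D" "\<not> vanishes_on G {q}"
      using CD pq Z unfolding closedin_subtopology_zariski[OF I S] by blast
    have "vanishes_on (\<lambda>v. F v * G v) Z"
      unfolding vanishes_on_def
    proof (intro ballI)
      fix x v assume "x \<in> Z" "v \<in> x - {0}"
      then show "F v * G v = 0" using CD F(2) G(2) by (auto simp: vanishes_on_def)
    qed
    from prime[OF F(1) G(1) this] show False
      using F(3) G(3) pq vanishes_on_iff_points[of F Z] vanishes_on_iff_points[of G Z] by blast
  qed
qed

lemma linear_form_separating:
  assumes I: "finite I" and p: "p \<in> proj_space I" and q: "q \<in> proj_space I" and "p \<noteq> q"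
  obtains F where "F \<in> forms I 1" "vanishes_on F {p}" "\<not> vanishes_on F {q}"
proof -
  obtain v where v: "v \<in> coord_space I" "v \<noteq> 0" "p = cvec.span {v}" using p by (rule proj_spaceE)
  obtain w where w: "w \<in> coord_space I" "w \<noteq> 0" "q = cvec.span {w}" using q by (rule proj_spaceE)
  obtain i where i: "v i \<noteq> 0" using v(2) by (auto simp: fun_eq_iff)
  have "\<exists>j. v i * w j \<noteq> w i * v j"
  proof (rule ccontr)
    assume "\<not> ?thesis"
    then obtain a where eq: "w = (\<lambda>j. a * v j)"
      using i by (intro that[of "w i / v i"]) (auto simp: fun_eq_iff field_simps)
    then have a: "a \<noteq> 0" using w(2) by (auto simp: fun_eq_iff)
    have "w \<in> cvec.span {v}" by (auto simp: eq cvec.span_singleton)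
    moreover have "v = (\<lambda>j. (1 / a) * w j)" using a by (simp add: eq)
    then have "v \<in> cvec.span {w}" unfolding cvec.span_singleton by (rule range_eqI)
    ultimately have "p = q" by (simp add: v w cvec.span_eq)
    with \<open>p \<noteq> q\<close> show False ..
  qed
  then obtain j where j: "v i * w j \<noteq> w i * v j" ..
  have "i \<in> I" using v(1) i by (auto simp: coord_space_def)
  moreover have "j \<in> I"
  proof (rule ccontr)
    assume "j \<notin> I"
    then have "v j = 0" "w j = 0" using v(1) w(1) by (simp_all add: coord_space_def)
    with j show False by simp
  qed
  ultimately have ij: "i \<in> I" "j \<in> I" .
  \<comment> \<open>A 2 x 2 minor of the coordinates of \<open>v\<close> and \<open>x\<close>. Since
    \<open>v i\<close> is nonzero, vanishing of these minors at \<open>w\<close> for all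
    \<open>j\<close> would make \<open>w\<close> a multiple of \<open>v\<close>.\<close>
  let ?F = "\<lambda>x. v i * x j - v j * x i"
  have F: "?F \<in> forms I 1" by (intro forms_diff forms_scale forms_coord I ij)
  show thesis
    by (rule that[OF F])
      (use j in \<open>simp_all only: v(3) w(3) vanishes_on_span[OF F v(2)] vanishes_on_span[OF F w(2)], simp_all add: mult.commute\<close>)
qed

text \<open>Products of separating linear forms make every subset of \<open>S\<close> closed, so
  irreducible sets are single points and no chain has a proper step.\<close>

lemma zdim_finite:
  assumes I: "finite I" and S: "S \<subseteq> proj_space I" and fin: "finite S"
  shows "zdim I S = 0"
proof -
  let ?T = "subtopology (zariski I) S"
  have closed: "closedin ?T C" if CS: "C \<subseteq> S" for C
    unfolding closedin_subtopology_zariski[OF I S]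
  proof (intro conjI ballI CS)
    fix p assume p: "p \<in> S - C"
    have "\<forall>c\<in>C. \<exists>F. F \<in> forms I 1 \<and> vanishes_on F {c} \<and> \<not> vanishes_on F {p}"
    proof
      fix c assume "c \<in> C"
      then have "c \<in> proj_space I" "p \<in> proj_space I" "c \<noteq> p" using CS S p by auto
      from linear_form_separating[OF I this]
      show "\<exists>F. F \<in> forms I 1 \<and> vanishes_on F {c} \<and> \<not> vanishes_on F {p}" by blast
    qed
    then obtain F where F: "\<And>c. c \<in> C \<Longrightarrow> F c \<in> forms I 1"
      "\<And>c. c \<in> C \<Longrightarrow> vanishes_on (F c) {c}" "\<And>c. c \<in> C \<Longrightarrow> \<not> vanishes_on (F c) {p}" by metis
    have C: "finite C" using fin CS by (rule finite_subset[rotated])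
    let ?G = "\<lambda>v. \<Prod>c\<in>C. F c v"
    have G: "?G \<in> forms I (\<Sum>c\<in>C. 1)" by (intro forms_prod I F(1))
    obtain v where v: "v \<noteq> 0" "p = cvec.span {v}" using p S by (blast elim: proj_spaceE)
    have "\<not> vanishes_on ?G {p}"
      using F(3) vanishes_on_span[OF F(1) v(1)] C
      unfolding v(2) vanishes_on_span[OF G v(1)] by auto
    moreover have "vanishes_on ?G C"
      using F(2) C by (auto simp: vanishes_on_def)
    ultimately show "\<exists>e. \<exists>F\<in>forms I e. vanishes_on F C \<and> \<not> vanishes_on F {p}" using G by blast
  qed
  have single: "\<exists>p. Z = {p}" if Z: "irreducible_in ?T Z" for Z
  proof -
    obtain p where p: "p \<in> Z" using Z by (auto simp: irreducible_in_def)
    have "Z \<subseteq> S" using Z S by (auto simp: irreducible_in_def topspace_zariski[OF I])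
    then have "closedin ?T {p}" "closedin ?T (Z - {p})" using p by (auto intro: closed)
    moreover have "Z \<subseteq> {p} \<union> (Z - {p})" by blast
    ultimately have "Z \<subseteq> {p} \<or> Z \<subseteq> Z - {p}" using Z unfolding irreducible_in_def by blast
    with p show ?thesis by blast
  qed
  have "krull_dim ?T \<le> 0"
    unfolding krull_dim_def
  proof (rule Sup_least, clarify)
    fix k Z assume Z: "\<forall>i\<le>k. closedin ?T (Z i) \<and> irreducible_in ?T (Z i)" "\<forall>i<k. Z i \<subset> Z (Suc i)"
    have "k = 0"
    proof (rule ccontr)
      assume "k \<noteq> 0"
      then have "Z 0 \<subset> Z (Suc 0)" "irreducible_in ?T (Z 0)" "irreducible_in ?T (Z (Suc 0))" using Z by auto
      with single show False by (metis empty_not_insert psubset_insert_iff singletonD subset_singletonD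
          insert_not_empty psubset_imp_subset less_irrefl)
    qed
    then show "enat k \<le> 0" by (simp add: zero_enat_def)
  qed
  then show ?thesis by (simp add: zdim_def)
qed

section \<open>Krull dimension\<close>

text \<open>Otherwise the rows of \<open>M\<close> would be \<open>card S\<close> independent
  vectors in a span of \<open>card B\<close> unit vectors. This serves the dimension count and also
  passes a linear form through two points.\<close>

lemma homogeneous_system_nontrivial_solution:
  fixes M :: "'a \<Rightarrow> 'b \<Rightarrow> complex"
  assumes S: "finite S" and B: "finite B" and less: "card B < card S"
  obtains c where "\<exists>a\<in>S. c a \<noteq> 0" "\<And>b. b \<in> B \<Longrightarrow> (\<Sum>a\<in>S. c a * M a b) = 0"
proof -
  have "\<exists>c. (\<exists>a\<in>S. c a \<noteq> 0) \<and> (\<forall>b\<in>B. (\<Sum>a\<in>S. c a * M a b) = 0)"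
  proof (rule ccontr)
    assume no: "\<not> ?thesis"
    define f where "f = (\<lambda>a b. if b \<in> B then M a b else 0)"
    have ind: "c a = 0" if s: "\<And>b. (\<Sum>a\<in>S. c a * f a b) = 0" and a: "a \<in> S" for c a
    proof -
      have "(\<Sum>a\<in>S. c a * M a b) = 0" if "b \<in> B" for b
        using s[of b] that by (simp add: f_def)
      with no a show ?thesis by blast
    qed
    have inj: "inj_on f S" by (rule cvec_independent_image(1)) (use S ind in blast)+
    have indep: "cvec.independent (f ` S)" by (rule cvec_independent_image(2)) (use S ind in blast)+
    define e where "e = (\<lambda>b x::'b. if x = b then 1 else 0 :: complex)"
    have "f a \<in> cvec.span (e ` B)" for a
    proof -
      have fx: "f a x = (\<Sum>b\<in>B. f a b * e b x)" for x
        using B by (simp add: e_def f_def if_distrib[of "\<lambda>y. _ * y"] cong: if_cong)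
      have "f a = (\<Sum>b\<in>B. (\<lambda>x. f a b * e b x))" by (rule ext, subst sum_fun_apply, rule fx)
      also have "\<dots> \<in> cvec.span (e ` B)" by (intro cvec.span_sum cvec.span_scale cvec.span_base imageI)
      finally show ?thesis .
    qed
    then have "f ` S \<subseteq> cvec.span (e ` B)" by blast
    from cvec.independent_span_bound[OF finite_imageI[OF B] indep this]
    have "card S \<le> card (e ` B)" by (simp add: card_image[OF inj])
    also have "\<dots> \<le> card B" by (rule card_image_le[OF B])
    finally show False using less by simp
  qed
  with that show thesis by blast
qed

lemma forms_linear_dependence:
  assumes I: "finite I" and S: "finite S" and F: "\<And>a. a \<in> S \<Longrightarrow> F a \<in> forms I e"
    and less: "card (exponents I e) < card S"
  obtains c where "\<exists>a\<in>S. c a \<noteq> 0" "\<And>v. (\<Sum>a\<in>S. c a * F a v) = 0"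
proof -
  have "\<forall>a\<in>S. \<exists>m. F a = (\<lambda>v. \<Sum>\<alpha>\<in>exponents I e. m \<alpha> * monom_eval I \<alpha> v)"
    using F by (blast elim: formsE)
  then obtain M where M: "\<And>a. a \<in> S \<Longrightarrow> F a = (\<lambda>v. \<Sum>\<alpha>\<in>exponents I e. M a \<alpha> * monom_eval I \<alpha> v)"
    by metis
  obtain c where c: "\<exists>a\<in>S. c a \<noteq> 0" "\<And>\<alpha>. \<alpha> \<in> exponents I e \<Longrightarrow> (\<Sum>a\<in>S. c a * M a \<alpha>) = 0"
    using homogeneous_system_nontrivial_solution[OF S finite_exponents[OF I] less, of M] by blast
  have "(\<Sum>a\<in>S. c a * F a v) = 0" for v
  proof -
    have "(\<Sum>a\<in>S. c a * F a v) = (\<Sum>a\<in>S. \<Sum>\<alpha>\<in>exponents I e. c a * M a \<alpha> * monom_eval I \<alpha> v)"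
      by (rule sum.cong) (simp_all add: M sum_distrib_left mult.assoc)
    also have "\<dots> = (\<Sum>\<alpha>\<in>exponents I e. (\<Sum>a\<in>S. c a * M a \<alpha>) * monom_eval I \<alpha> v)"
      by (subst sum.swap) (simp add: sum_distrib_right)
    also have "\<dots> = 0" using c(2) by simp
    finally show ?thesis .
  qed
  with c(1) that show thesis by blast
qed

text \<open>Forms in the many target coordinates become forms in only \<open>n + 1\<close>
  variables, where counting monomials is effective.\<close>

lemma forms_compose_veronese_vec:
  assumes "F \<in> forms (exponents {0..n} d) e"
  shows "(\<lambda>x. F (veronese_vec n d x)) \<in> forms {0..n} (e * d)"
proof -
  let ?E = "exponents {0..n} d"
  obtain c where c: "F = (\<lambda>v. \<Sum>\<beta>\<in>exponents ?E e. c \<beta> * monom_eval ?E \<beta> v)"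
    using assms by (rule formsE)
  have "(\<lambda>x. monom_eval ?E \<beta> (veronese_vec n d x)) \<in> forms {0..n} (e * d)" if "\<beta> \<in> exponents ?E e" for \<beta>
  proof -
    have "(\<lambda>x. \<Prod>\<alpha>\<in>?E. monom_eval {0..n} \<alpha> x ^ \<beta> \<alpha>) \<in> forms {0..n} (\<Sum>\<alpha>\<in>?E. \<beta> \<alpha> * d)"
      by (intro forms_prod forms_power forms_monom) simp_all
    moreover have "(\<Sum>\<alpha>\<in>?E. \<beta> \<alpha> * d) = e * d"
      using that by (simp add: exponents_def flip: sum_distrib_right)
    moreover have "(\<lambda>x. monom_eval ?E \<beta> (veronese_vec n d x)) =
        (\<lambda>x. \<Prod>\<alpha>\<in>?E. monom_eval {0..n} \<alpha> x ^ \<beta> \<alpha>)"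
      by (simp add: monom_eval_def[of ?E] veronese_vec_def)
    ultimately show ?thesis by simp
  qed
  then show ?thesis unfolding c by (intro forms_sum forms_scale)
qed

text \<open>Peeling off the lowest power of the last form shows that forms cutting out successive
  members of a chain of irreducible sets satisfy no homogenised polynomial relation.\<close>

lemma chain_forms_independent:
  fixes G :: "nat \<Rightarrow> ('i \<Rightarrow> complex) \<Rightarrow> complex" and e :: "nat \<Rightarrow> nat" and A :: "(nat \<Rightarrow> nat) set"
  assumes I: "finite I" and S: "S \<subseteq> proj_space I"
    and irred: "\<And>i. i \<le> k \<Longrightarrow> irreducible_in (subtopology (zariski I) S) (Z i)"
    and mono: "\<And>i. i < k \<Longrightarrow> Z i \<subseteq> Z (Suc i)"
    and G: "\<And>i. i < k \<Longrightarrow> G i \<in> forms I (e i)"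
    and G0: "\<And>i. i < k \<Longrightarrow> vanishes_on (G i) (Z i)"
    and G1: "\<And>i. i < k \<Longrightarrow> \<not> vanishes_on (G i) (Z (Suc i))"
    and L: "L \<in> forms I 1" "\<not> vanishes_on L (Z 0)"
  shows "j \<le> k \<Longrightarrow> finite A \<Longrightarrow> A \<noteq> {} \<Longrightarrow> (\<And>a. a \<in> A \<Longrightarrow> c a \<noteq> 0) \<Longrightarrow>
    (\<And>a b. a \<in> A \<Longrightarrow> b \<in> A \<Longrightarrow> (\<forall>i<j. a i = b i) \<Longrightarrow> a = b) \<Longrightarrow>
    (\<And>a. a \<in> A \<Longrightarrow> (\<Sum>i<j. a i * e i) \<le> m) \<Longrightarrow>
    \<not> vanishes_on (\<lambda>v. \<Sum>a\<in>A. c a * ((\<Prod>i<j. G i v ^ a i) * L v ^ (m - (\<Sum>i<j. a i * e i)))) (Z j)"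
proof (induction j arbitrary: A m)
  case 0
  obtain a where a: "a \<in> A" using 0 by blast
  \<comment> \<open>For \<open>j = 0\<close> any two members of \<open>A\<close> agree vacuously, so
    the sum is a single nonzero multiple of \<open>L v ^ m\<close>.\<close>
  have "A = {a}" using 0(5) a by auto
  moreover obtain p v where "p \<in> Z 0" "v \<in> p - {0}" "L v \<noteq> 0" using L(2) by (auto simp: vanishes_on_def)
  moreover have "c a \<noteq> 0" using 0(4) a by blast
  ultimately show ?case unfolding vanishes_on_def by force
next
  case (Suc j)
  \<comment> \<open>The relation is \<open>G j v ^ b\<close> times the quotient \<open>Q\<close>.
    Where \<open>G j\<close> vanishes, only the terms in \<open>A'\<close>, whose exponent at
    \<open>j\<close> is minimal, survive in \<open>Q\<close>.\<close>
  define b where "b = Min ((\<lambda>a. a j) ` A)"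
  have b_le: "b \<le> a j" if "a \<in> A" for a using that Suc.prems(2) by (simp add: b_def)
  have "b \<in> (\<lambda>a. a j) ` A" unfolding b_def using Suc.prems(2,3) by (intro Min_in) auto
  then obtain a0 where a0: "a0 \<in> A" "a0 j = b" by blast
  have jk: "j < k" using Suc.prems(1) by simp
  define r where "r = (\<lambda>a::nat \<Rightarrow> nat. m - (\<Sum>i<Suc j. a i * e i))"
  define Q where "Q = (\<lambda>v. \<Sum>a\<in>A. c a * ((\<Prod>i<j. G i v ^ a i) * G j v ^ (a j - b) * L v ^ r a))"
  define A' where "A' = {a \<in> A. a j = b}"
  have r: "r a + (\<Sum>i<j. a i * e i) + (a j - b) * e j = m - b * e j" if a: "a \<in> A" for a
  proof -
    have "(\<Sum>i<j. a i * e i) + a j * e j \<le> m" using Suc.prems(6)[OF a] by simp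
    moreover have "b * e j \<le> a j * e j" using b_le[OF a] by simp
    ultimately show ?thesis by (simp add: r_def diff_mult_distrib)
  qed
  have "(\<lambda>v. (\<Prod>i<j. G i v ^ a i) * G j v ^ (a j - b) * L v ^ r a) \<in> forms I (m - b * e j)"
    if a: "a \<in> A" for a
  proof -
    have "(\<lambda>v. (\<Prod>i<j. G i v ^ a i) * G j v ^ (a j - b) * L v ^ r a) \<in>
        forms I ((\<Sum>i<j. a i * e i) + (a j - b) * e j + r a * 1)"
      using jk by (intro forms_mult forms_prod forms_power I G L) auto
    moreover have "(\<Sum>i<j. a i * e i) + (a j - b) * e j + r a * 1 = m - b * e j" using r[OF a] by simp
    ultimately show ?thesis by simp
  qed
  then have Q: "Q \<in> forms I (m - b * e j)" unfolding Q_def by (intro forms_sum forms_scale)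
  have Gb: "(\<lambda>v. G j v ^ b) \<in> forms I (b * e j)" by (intro forms_power I G jk)
  have A': "\<not> vanishes_on (\<lambda>v. \<Sum>a\<in>A'. c a * ((\<Prod>i<j. G i v ^ a i) *
      L v ^ (m - b * e j - (\<Sum>i<j. a i * e i)))) (Z j)"
  proof (rule Suc.IH)
    show "finite A'" "A' \<noteq> {}" using Suc.prems(2) a0 by (auto simp: A'_def)
    show "a = a'" if "a \<in> A'" "a' \<in> A'" "\<forall>i<j. a i = a' i" for a a'
      using that Suc.prems(5)[of a a'] by (auto simp: A'_def less_Suc_eq)
    show "(\<Sum>i<j. a i * e i) \<le> m - b * e j" if "a \<in> A'" for a
      using that r[of a] by (simp add: A'_def)
  qed (use Suc.prems jk in \<open>auto simp: A'_def\<close>)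
  have Q_eq: "Q v = (\<Sum>a\<in>A'. c a * ((\<Prod>i<j. G i v ^ a i) * L v ^ (m - b * e j - (\<Sum>i<j. a i * e i))))"
    if "G j v = 0" for v
  proof -
    have "Q v = (\<Sum>a\<in>A'. c a * ((\<Prod>i<j. G i v ^ a i) * G j v ^ (a j - b) * L v ^ r a))"
      unfolding Q_def
    proof (rule sum.mono_neutral_right)
      show "\<forall>a\<in>A - A'. c a * ((\<Prod>i<j. G i v ^ a i) * G j v ^ (a j - b) * L v ^ r a) = 0"
      proof
        fix a assume "a \<in> A - A'"
        then have "a j - b \<noteq> 0" using b_le[of a] by (auto simp: A'_def)
        with that show "c a * ((\<Prod>i<j. G i v ^ a i) * G j v ^ (a j - b) * L v ^ r a) = 0" by simp
      qed
    qed (use Suc.prems(2) in \<open>auto simp: A'_def\<close>)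
    also have "\<dots> = (\<Sum>a\<in>A'. c a * ((\<Prod>i<j. G i v ^ a i) * L v ^ (m - b * e j - (\<Sum>i<j. a i * e i))))"
    proof (rule sum.cong[OF refl])
      fix a assume "a \<in> A'"
      then have "a j = b" "r a = m - b * e j - (\<Sum>i<j. a i * e i)" using r[of a] by (auto simp: A'_def)
      then show "c a * ((\<Prod>i<j. G i v ^ a i) * G j v ^ (a j - b) * L v ^ r a) =
          c a * ((\<Prod>i<j. G i v ^ a i) * L v ^ (m - b * e j - (\<Sum>i<j. a i * e i)))" by simp
    qed
    finally show ?thesis .
  qed
  show ?case
  proof
    assume van: "vanishes_on (\<lambda>v. \<Sum>a\<in>A. c a * ((\<Prod>i<Suc j. G i v ^ a i) *
      L v ^ (m - (\<Sum>i<Suc j. a i * e i)))) (Z (Suc j))"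
    have "(\<Sum>a\<in>A. c a * ((\<Prod>i<Suc j. G i v ^ a i) * L v ^ (m - (\<Sum>i<Suc j. a i * e i)))) =
        G j v ^ b * Q v" for v
      unfolding Q_def sum_distrib_left
    proof (rule sum.cong[OF refl])
      fix a assume "a \<in> A"
      then have "G j v ^ a j = G j v ^ b * G j v ^ (a j - b)"
        using b_le by (simp flip: power_add)
      then show "c a * ((\<Prod>i<Suc j. G i v ^ a i) * L v ^ (m - (\<Sum>i<Suc j. a i * e i))) =
          G j v ^ b * (c a * ((\<Prod>i<j. G i v ^ a i) * G j v ^ (a j - b) * L v ^ r a))"
        by (simp add: r_def mult_ac)
    qed
    with van have "vanishes_on (\<lambda>v. G j v ^ b * Q v) (Z (Suc j))" by simp
    \<comment> \<open>Irreducibility of \<open>Z (Suc j)\<close> cancels the power of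
      \<open>G j\<close>, which does not vanish there. On the smaller set \<open>Z j\<close>, where
      \<open>G j\<close> does vanish, \<open>Q\<close> becomes a relation of the kind excluded by
      induction.\<close>
    from irreducible_in_vanishes_on_mult[OF I S irred[OF Suc.prems(1)] Gb Q this]
    have "vanishes_on Q (Z (Suc j))"
      using G1[OF jk] by (auto simp: vanishes_on_def)
    then have Q0: "vanishes_on Q (Z j)" using mono[OF jk] by (auto simp: vanishes_on_def)
    have "vanishes_on (\<lambda>v. \<Sum>a\<in>A'. c a * ((\<Prod>i<j. G i v ^ a i) *
      L v ^ (m - b * e j - (\<Sum>i<j. a i * e i)))) (Z j)"
      unfolding vanishes_on_def
    proof (intro ballI)
      fix p v assume pv: "p \<in> Z j" "v \<in> p - {0}"
      then have "G j v = 0" "Q v = 0" using Q0 G0[OF jk] by (auto simp: vanishes_on_def)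
      then show "(\<Sum>a\<in>A'. c a * ((\<Prod>i<j. G i v ^ a i) *
        L v ^ (m - b * e j - (\<Sum>i<j. a i * e i)))) = 0" using Q_eq by simp
    qed
    with A' show False ..
  qed
qed

text \<open>A chain reaching index \<open>n + 1\<close> yields \<open>n + 1\<close> forms
  \<open>G i\<close>. Their products with exponents up to \<open>q\<close>, padded by powers of
  \<open>L\<close> to degree \<open>m\<close>, outnumber the monomials of degree
  \<open>m * d\<close> in \<open>n + 1\<close> variables, so their pullbacks satisfy a linear
  relation, against \<open>chain_forms_independent\<close>.\<close>

lemma zdim_veronese_le:
  assumes d: "d \<ge> 1" and S: "S \<subseteq> veronese_variety n d"
  shows "zdim (exponents {0..n} d) S \<le> enat n"
  unfolding zdim_def krull_dim_def
proof (rule Sup_least, clarify)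
  let ?E = "exponents {0..n} d" and ?k = "Suc n"
  let ?T = "subtopology (zariski ?E) S"
  have E: "finite ?E" by (simp add: finite_exponents)
  have SP: "S \<subseteq> proj_space ?E" using S veronese_variety_subset[OF d] by blast
  fix k Z assume Z: "\<forall>i\<le>k. closedin ?T (Z i) \<and> irreducible_in ?T (Z i)" "\<forall>i<k. Z i \<subset> Z (Suc i)"
  have ZS: "Z i \<subseteq> S" if "i \<le> k" for i
    using Z(1) that SP by (auto simp: irreducible_in_def topspace_zariski[OF E])
  have "k \<le> n"
  proof (rule ccontr)
    assume "\<not> k \<le> n"
    then have kn: "?k \<le> k" by simp
    have "\<exists>e G. G \<in> forms ?E e \<and> vanishes_on G (Z i) \<and> \<not> vanishes_on G (Z (Suc i))" if i: "i < k" for i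
    proof -
      obtain p where p: "p \<in> Z (Suc i)" "p \<notin> Z i" using Z(2) i by blast
      have "p \<in> S" using p ZS[of "Suc i"] i by auto
      moreover have "closedin ?T (Z i)" using Z(1) i by simp
      ultimately obtain e G where G: "G \<in> forms ?E e" "vanishes_on G (Z i)" "\<not> vanishes_on G {p}"
        using p unfolding closedin_subtopology_zariski[OF E SP] by blast
      then have "\<not> vanishes_on G (Z (Suc i))" using p vanishes_on_iff_points[of G "Z (Suc i)"] by blast
      with G show ?thesis by blast
    qed
    then obtain e G where G: "\<And>i. i < k \<Longrightarrow> G i \<in> forms ?E (e i)"
      "\<And>i. i < k \<Longrightarrow> vanishes_on (G i) (Z i)" "\<And>i. i < k \<Longrightarrow> \<not> vanishes_on (G i) (Z (Suc i))" by metis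
    have "irreducible_in ?T (Z 0)" using Z(1) by simp
    then obtain p where p: "p \<in> Z 0" by (auto simp: irreducible_in_def)
    then have "p \<in> proj_space ?E" using ZS[of 0] SP by auto
    then obtain y where y: "y \<in> coord_space ?E" "y \<noteq> 0" "p = cvec.span {y}" by (rule proj_spaceE)
    obtain \<alpha> where \<alpha>: "y \<alpha> \<noteq> 0" using y(2) by (auto simp: fun_eq_iff)
    then have \<alpha>E: "\<alpha> \<in> ?E" using y(1) by (auto simp: coord_space_def)
    \<comment> \<open>A coordinate that is nonzero at a point of the smallest member of the chain;
      its powers bring the products below to a common degree.\<close>
    define L where "L = (\<lambda>y::(nat \<Rightarrow> nat) \<Rightarrow> complex. y \<alpha>)"
    have L: "L \<in> forms ?E 1" unfolding L_def by (rule forms_coord[OF E \<alpha>E])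
    have L0: "\<not> vanishes_on L (Z 0)"
      using p y(2,3) \<alpha> cvec.span_base[of y "{y}"] by (auto simp: vanishes_on_def L_def)
    \<comment> \<open>With \<open>m = q * s\<close>, all products with exponents up to
      \<open>q\<close> fit into degree \<open>m\<close>. As
      \<open>m * d + 1 \<le> (q + 1) * (s * d + 1)\<close>, the choice of \<open>q\<close> bounds
      the number of monomials of degree \<open>m * d\<close> by \<open>(q + 1) ^ n * q\<close>,
      which is less than the number \<open>(q + 1) ^ (n + 1)\<close> of exponent vectors.\<close>
    define s where "s = (\<Sum>i<?k. e i)"
    define q where "q = (s * d + 1) ^ n"
    define m where "m = q * s"
    define A where "A = PiE {..<?k} (\<lambda>_. {..q})"
    define M where "M = (\<lambda>a v. (\<Prod>i<?k. G i v ^ a i) * L v ^ (m - (\<Sum>i<?k. a i * e i)))"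
    have A: "finite A" "card A = (q + 1) ^ ?k" by (simp_all add: A_def finite_PiE card_PiE)
    have deg: "(\<Sum>i<?k. a i * e i) \<le> m" if "a \<in> A" for a
    proof -
      have "(\<Sum>i<?k. a i * e i) \<le> (\<Sum>i<?k. q * e i)"
        by (intro sum_mono mult_right_mono) (use that in \<open>auto simp: A_def PiE_iff\<close>)
      then show ?thesis by (simp only: m_def s_def sum_distrib_left)
    qed
    have M: "M a \<in> forms ?E m" if a: "a \<in> A" for a
    proof -
      have "M a \<in> forms ?E ((\<Sum>i<?k. a i * e i) + (m - (\<Sum>i<?k. a i * e i)) * 1)"
        unfolding M_def using kn by (intro forms_mult forms_prod forms_power E G L) auto
      then show ?thesis using deg[OF a] by simp
    qed
    have "card (exponents {0..n} (m * d)) \<le> (m * d + 1) ^ n" by (rule card_exponents_le)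
    also have "\<dots> \<le> ((q + 1) * (s * d + 1)) ^ n"
      by (intro power_mono) (simp_all add: m_def algebra_simps)
    also have "\<dots> = (q + 1) ^ n * q" by (simp only: power_mult_distrib q_def)
    also have "\<dots> < card A" by (simp add: A(2))
    finally have less: "card (exponents {0..n} (m * d)) < card A" .
    obtain c where c: "\<exists>a\<in>A. c a \<noteq> 0" "\<And>x. (\<Sum>a\<in>A. c a * M a (veronese_vec n d x)) = 0"
      using forms_linear_dependence[where F = "\<lambda>a x. M a (veronese_vec n d x)",
          OF _ A(1) forms_compose_veronese_vec[OF M] less] by blast
    define A' where "A' = {a \<in> A. c a \<noteq> 0}"
    define P where "P = (\<lambda>v. \<Sum>a\<in>A'. c a * M a v)"
    have P: "P \<in> forms ?E m" unfolding P_def by (intro forms_sum forms_scale M) (simp add: A'_def)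
    have P_eq: "P v = (\<Sum>a\<in>A. c a * M a v)" for v
      unfolding P_def A'_def by (rule sum.mono_neutral_left) (use A(1) in auto)
    have "vanishes_on P (veronese_variety n d)"
      unfolding form_vanishes_on_veronese_variety[OF d P] using c(2) P_eq by simp
    moreover have "Z ?k \<subseteq> veronese_variety n d" using ZS[OF kn] S by blast
    ultimately have "vanishes_on P (Z ?k)" by (auto simp: vanishes_on_def)
    moreover have "\<not> vanishes_on P (Z ?k)"
      unfolding P_def M_def
    proof (rule chain_forms_independent[OF E SP, where k = ?k])
      show "a = b" if "a \<in> A'" "b \<in> A'" "\<forall>i<?k. a i = b i" for a b
        using that by (intro PiE_ext[of a "{..<?k}" "\<lambda>_. {..q}" b]) (auto simp: A'_def A_def)
      show "finite A'" "A' \<noteq> {}" using A(1) c(1) by (auto simp: A'_def)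
      show "(\<Sum>i<?k. a i * e i) \<le> m" if "a \<in> A'" for a using deg that by (simp add: A'_def)
      show "L \<in> forms ?E 1" "\<not> vanishes_on L (Z 0)" by fact+
      show "c a \<noteq> 0" if "a \<in> A'" for a using that by (simp add: A'_def)
      show "Z i \<subseteq> Z (Suc i)" if "i < ?k" for i
      proof -
        have "i < k" using that kn by simp
        then show ?thesis using Z(2) by blast
      qed
    qed (use kn Z G in auto)
    ultimately show False by contradiction
  qed
  then show "enat k \<le> enat n" by simp
qed

section \<open>Lower bound for the dimension, and smoothness\<close>

text \<open>The image of the subspace of the first \<open>k + 1\<close> coordinates:
  \<open>k = n\<close> gives the variety itself, \<open>k = 1\<close> the image of the line on which
  points are chosen later.\<close>

definition veronese_flat :: "nat \<Rightarrow> nat \<Rightarrow> nat \<Rightarrow> (nat \<Rightarrow> nat) point set" where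
  "veronese_flat n d k = {cvec.span {veronese_vec n d v} | v. v \<in> coord_space {0..k} \<and> v \<noteq> 0}"

text \<open>The flats of index at most \<open>k\<close> form the chain. The coordinates with values
  \<open>v j ^ d\<close>, \<open>j > i\<close>, cut out the flat of index \<open>i\<close>, and it
  is irreducible because two of its points can be joined by a line, on which forms become
  polynomials in one variable.\<close>

lemma zdim_ge_veronese_flat:
  assumes d: "d \<ge> 1" and k: "k \<le> n" and S: "S \<subseteq> veronese_variety n d"
    and flat: "veronese_flat n d k \<subseteq> S"
  shows "enat k \<le> zdim (exponents {0..n} d) S"
proof -
  let ?E = "exponents {0..n} d" and ?Z = "veronese_flat n d"
  let ?T = "subtopology (zariski ?E) S"
  have E: "finite ?E" by (simp add: finite_exponents)
  have SP: "S \<subseteq> proj_space ?E" using S veronese_variety_subset[OF d] by blast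
  have cs: "coord_space {0..i} \<subseteq> coord_space {0..j}" if "i \<le> j" for i j :: nat
    using that by (auto simp: coord_space_def)
  have ZS: "?Z i \<subseteq> S" if "i \<le> k" for i
    using flat cs[OF that] by (auto simp: veronese_flat_def)
  have nz: "veronese_vec n d v \<noteq> 0" if "v \<in> coord_space {0..i}" "v \<noteq> 0" "i \<le> n" for v i
    using veronese_vec_nonzero[of v n d] cs[of i n] that d by blast
  have coord: "(\<lambda>y. y (star_exponent d j j)) \<in> forms ?E 1" if "j \<le> n" for j
    by (intro forms_coord E star_exponent_in d that)
  have val: "veronese_vec n d v (star_exponent d j j) = v j ^ d" if "j \<le> n" for v j
    using veronese_vec_star[OF d that that, of v] d by (simp flip: power_Suc2)
  have van: "vanishes_on (\<lambda>y. y (star_exponent d j j)) (?Z i)" if "i < j" "j \<le> n" for i j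
  proof (subst vanishes_on_iff_points, intro ballI)
    fix p assume "p \<in> ?Z i"
    then obtain v where v: "v \<in> coord_space {0..i}" "v \<noteq> 0" "p = cvec.span {veronese_vec n d v}"
      by (auto simp: veronese_flat_def)
    have "v j = 0" using v(1) that by (simp add: coord_space_def)
    then show "vanishes_on (\<lambda>y. y (star_exponent d j j)) {p}"
      unfolding v(3) using nz[OF v(1,2)] that d
      by (subst vanishes_on_span[OF coord]) (simp_all add: val)
  qed
  have closed: "closedin ?T (?Z i)" if i: "i \<le> k" for i
    unfolding closedin_subtopology_zariski[OF E SP]
  proof (intro conjI ballI ZS i)
    fix p assume p: "p \<in> S - ?Z i"
    then obtain v where v: "v \<in> coord_space {0..n}" "v \<noteq> 0" "p = cvec.span {veronese_vec n d v}"
      using S by (auto simp: veronese_variety_eq)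
    then have "v \<notin> coord_space {0..i}" using p by (auto simp: veronese_flat_def)
    then obtain j where j: "i < j" "v j \<noteq> 0" by (auto simp: coord_space_def not_le)
    then have jn: "j \<le> n" using v(1) by (auto simp: coord_space_def)
    have "\<not> vanishes_on (\<lambda>y. y (star_exponent d j j)) {p}"
      unfolding v(3) using nz[OF v(1,2)] j
      by (subst vanishes_on_span[OF coord[OF jn]]) (simp_all add: val[OF jn])
    with van[OF j(1) jn] coord[OF jn]
    show "\<exists>e. \<exists>F\<in>forms ?E e. vanishes_on F (?Z i) \<and> \<not> vanishes_on F {p}" by blast
  qed
  have irred: "irreducible_in ?T (?Z i)" if i: "i \<le> k" for i
  proof (rule irreducible_in_subtopology_zariskiI[OF E SP _ ZS[OF i]])
    have "(\<lambda>j. if j = 0 then 1 else 0) \<in> coord_space {0..i} - {0}"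
      by (auto simp: coord_space_def fun_eq_iff)
    then show "?Z i \<noteq> {}" by (auto simp: veronese_flat_def)
    fix a b F G assume F: "F \<in> forms ?E a" and G: "G \<in> forms ?E b"
      and FG: "vanishes_on (\<lambda>v. F v * G v) (?Z i)"
    have pt: "vanishes_on H {cvec.span {veronese_vec n d v}} \<longleftrightarrow> H (veronese_vec n d v) = 0"
      if "H \<in> forms ?E e" "v \<in> coord_space {0..i}" "v \<noteq> 0" for H e v
      using vanishes_on_span[OF that(1) nz[OF that(2,3)]] i k by simp
    show "vanishes_on F (?Z i) \<or> vanishes_on G (?Z i)"
    proof (rule ccontr)
      assume no: "\<not> (vanishes_on F (?Z i) \<or> vanishes_on G (?Z i))"
      have "\<exists>v. v \<in> coord_space {0..i} \<and> v \<noteq> 0 \<and> H (veronese_vec n d v) \<noteq> 0"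
        if "H \<in> forms ?E e" "\<not> vanishes_on H (?Z i)" for H e
        using that pt[OF that(1)] vanishes_on_iff_points[of H "?Z i"] by (auto simp: veronese_flat_def)
      from this[OF F] this[OF G] no obtain v w where
        v: "v \<in> coord_space {0..i}" "v \<noteq> 0" "F (veronese_vec n d v) \<noteq> 0" and
        w: "w \<in> coord_space {0..i}" "w \<noteq> 0" "G (veronese_vec n d w) \<noteq> 0" by blast
      define l where "l = (\<lambda>t j. v j + t * (w j - v j))"
      obtain p where p: "\<And>t. F (veronese_vec n d (l t)) = poly p t"
        unfolding l_def by (rule poly_form_on_line[OF _ forms_compose_veronese_vec[OF F], of v "\<lambda>j. w j - v j"]) auto
      obtain q where q: "\<And>t. G (veronese_vec n d (l t)) = poly q t"
        unfolding l_def by (rule poly_form_on_line[OF _ forms_compose_veronese_vec[OF G], of v "\<lambda>j. w j - v j"]) auto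
      have "poly p 0 \<noteq> 0" using v(3) p[of 0] by (simp add: l_def)
      moreover have "poly q 1 \<noteq> 0" using w(3) q[of 1] by (simp add: l_def)
      moreover obtain j where j: "v j \<noteq> 0" using v(2) by (auto simp: fun_eq_iff)
      \<comment> \<open>The third factor vanishes at any parameter where the line runs through the
        origin. There \<open>l t\<close> represents no projective point, so the hypothesis on the
        product says nothing about \<open>p\<close> and \<open>q\<close>.\<close>
      ultimately have "p \<noteq> 0" "q \<noteq> 0" "[:v j, w j - v j:] \<noteq> 0" by auto
      then have "p * q * [:v j, w j - v j:] \<noteq> 0" by (simp only: mult_eq_0_iff) blast
      moreover have "poly (p * q * [:v j, w j - v j:]) t = 0" for t
      proof (cases "l t = 0")
        case True
        then have "l t j = 0" by simp
        then have "poly [:v j, w j - v j:] t = 0" by (simp add: l_def)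
        then show ?thesis by (simp only: poly_mult mult_zero_right)
      next
        case False
        have lt: "l t \<in> coord_space {0..i}" using v(1) w(1) by (simp add: l_def coord_space_def)
        then have "cvec.span {veronese_vec n d (l t)} \<in> ?Z i" using False by (auto simp: veronese_flat_def)
        then have "vanishes_on (\<lambda>v. F v * G v) {cvec.span {veronese_vec n d (l t)}}"
          using FG by (subst (asm) vanishes_on_iff_points) blast
        then have "poly p t = 0 \<or> poly q t = 0"
          using pt[OF forms_mult[OF E F G] lt False] by (simp add: p q)
        then show ?thesis by auto
      qed
      ultimately show False using poly_all_0_iff_0 by blast
    qed
  qed
  have strict: "?Z i \<subset> ?Z (Suc i)" if i: "i < k" for i
  proof -
    let ?u = "\<lambda>j. if j = Suc i then 1 else 0 :: complex"
    have u: "?u \<in> coord_space {0..Suc i}" "?u \<noteq> 0" by (auto simp: coord_space_def fun_eq_iff)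
    have Si: "Suc i \<le> n" using i k by simp
    have "\<not> vanishes_on (\<lambda>y. y (star_exponent d (Suc i) (Suc i))) {cvec.span {veronese_vec n d ?u}}"
      using nz[OF u Si] by (subst vanishes_on_span[OF coord[OF Si]]) (simp_all add: val[OF Si])
    then have "cvec.span {veronese_vec n d ?u} \<notin> ?Z i"
      using van[OF lessI Si] vanishes_on_iff_points[of _ "?Z i"] by blast
    moreover have "cvec.span {veronese_vec n d ?u} \<in> ?Z (Suc i)" using u by (auto simp: veronese_flat_def)
    moreover have "?Z i \<subseteq> ?Z (Suc i)" using cs[of i "Suc i"] by (auto simp: veronese_flat_def)
    ultimately show ?thesis by blast
  qed
  show ?thesis
    unfolding zdim_def krull_dim_def
    by (rule Sup_upper) (use closed irred strict in blast)
qed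

lemma zdim_veronese_variety:
  assumes "d \<ge> 1" shows "zdim (exponents {0..n} d) (veronese_variety n d) = enat n"
  using zdim_veronese_le[OF assms order_refl] zdim_ge_veronese_flat[OF assms order_refl order_refl]
  by (intro antisym) (auto simp: veronese_flat_def veronese_variety_eq)

text \<open>The star coordinates make the differential injective on the coordinates
  \<open>{0..n}\<close> at every point, so the affine tangent dimension is constantly
  \<open>n + 1\<close>, one more than the Krull dimension.\<close>

lemma smooth_locus_veronese_variety:
  assumes d: "d \<ge> 2"
  shows "smooth_locus (exponents {0..n} d) (veronese_variety n d) = veronese_variety n d"
proof -
  have "cvec.dim (tangent_space (exponents {0..n} d) (veronese_variety n d) p) = n + 1"
    if p: "p \<in> veronese_variety n d" for p
  proof -
    obtain v where v: "v \<in> coord_space {0..n}" "v \<noteq> 0" "p = cvec.span {veronese_vec n d v}"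
      using p by (auto simp: veronese_variety_eq)
    obtain j where j: "v j \<noteq> 0" using v(2) by (auto simp: fun_eq_iff)
    then have "j \<le> n" using v(1) by (auto simp: coord_space_def)
    then show ?thesis unfolding v(3) tangent_space_veronese[OF d v(1,2)] using dim_veronese_deriv[where v = v, OF d _ j] by blast
  qed
  then show ?thesis
    using d by (auto simp: smooth_locus_def zdim_veronese_variety one_enat_def)
qed

section \<open>Points on a line\<close>

text \<open>An independent subset of \<open>S\<close> spanning it, enlarged by \<open>w\<close>,
  carries a functional that is 0 on the subset and 1 at \<open>w\<close>; \<open>c\<close> lists its
  values on unit vectors. On the Veronese target these are the coefficients of a form of degree
  \<open>d\<close>.\<close>

lemma separating_functional:
  assumes I: "finite I" and S: "S \<subseteq> coord_space I" and w: "w \<in> coord_space I" "w \<notin> cvec.span S"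
  obtains c :: "'i \<Rightarrow> complex"
    where "\<And>s. s \<in> S \<Longrightarrow> (\<Sum>i\<in>I. c i * s i) = 0" "(\<Sum>i\<in>I. c i * w i) \<noteq> 0"
proof -
  interpret vp: vector_space_pair "\<lambda>(c::complex) (v::'i \<Rightarrow> complex) i. c * v i" "(*) :: complex \<Rightarrow> _"
    by unfold_locales (simp_all add: distrib_left distrib_right)
  obtain B where B: "B \<subseteq> S" "cvec.independent B" "S \<subseteq> cvec.span B"
    using cvec.maximal_independent_subset by blast
  have "w \<notin> cvec.span B" using w(2) cvec.span_mono[OF B(1)] by blast
  then have ind: "cvec.independent (insert w B)" using B(2) cvec.independent_insertI by blast
  obtain g where g: "Vector_Spaces.linear (\<lambda>(c::complex) (v::'i \<Rightarrow> complex) i. c * v i) (*) g"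
    "\<forall>x\<in>insert w B. g x = (if x = w then 1 else 0)"
    using vp.linear_independent_extend[OF ind, of "\<lambda>x. if x = w then 1 else 0"] by blast
  have gB: "g b = 0" if "b \<in> B" for b
    using g(2) that \<open>w \<notin> cvec.span B\<close> cvec.span_base by auto
  have g_span: "g x = 0" if "x \<in> cvec.span B" for x
    using that
  proof (induction rule: cvec.span_induct_alt)
    case base
    show ?case by (rule vp.linear_0[OF g(1)])
  next
    case (step c x y)
    then show ?case
      by (simp only: vp.linear_add[OF g(1)] vp.linear_scale[OF g(1)] gB mult_zero_right add_0)
  qed
  define e where "e = (\<lambda>i j::'i. if j = i then 1 else 0 :: complex)"
  have g_eq: "g v = (\<Sum>i\<in>I. g (e i) * v i)" if v: "v \<in> coord_space I" for v
  proof -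
    have vx: "v x = (\<Sum>i\<in>I. v i * e i x)" for x
      using I v by (auto simp: e_def coord_space_def if_distrib[of "\<lambda>y. _ * y"] cong: if_cong)
    have "v = (\<Sum>i\<in>I. (\<lambda>x. v i * e i x))" by (rule ext, subst sum_fun_apply, rule vx)
    then have "g v = g (\<Sum>i\<in>I. (\<lambda>x. v i * e i x))" by simp
    also have "\<dots> = (\<Sum>i\<in>I. g (\<lambda>x. v i * e i x))" by (rule vp.linear_sum[OF g(1)])
    also have "\<dots> = (\<Sum>i\<in>I. g (e i) * v i)"
      by (rule sum.cong[OF refl]) (simp add: vp.linear_scale[OF g(1)])
    finally show ?thesis .
  qed
  show thesis
  proof (rule that)
    show "(\<Sum>i\<in>I. g (e i) * s i) = 0" if "s \<in> S" for s
      by (rule trans[OF sym[OF g_eq] g_span]) (use B(3) S that in blast)+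
    show "(\<Sum>i\<in>I. g (e i) * w i) \<noteq> 0" unfolding g_eq[OF w(1), symmetric] using g(2) by simp
  qed
qed

text \<open>Directions \<open>u\<close> leaving the line are included, since whole tangent spaces
  have to be captured. For the form given by a separating functional, \<open>G\<close> is its
  derivative along the fixed \<open>u\<close>, and only values of \<open>G\<close> on the line
  matter.\<close>

lemma veronese_deriv_in_span_line:
  fixes a b :: complex
  assumes d: "d \<ge> 1" and K: "finite K" "card K \<ge> d"
    and span: "\<And>k u. k \<in> K \<Longrightarrow>
      veronese_deriv n d (\<lambda>i. if i = 0 then 1 else if i = 1 then k else 0) u \<in> cvec.span U"
    and U: "U \<subseteq> coord_space (exponents {0..n} d)"
  shows "veronese_deriv n d (\<lambda>i. if i = 0 then a else if i = 1 then b else 0) u \<in> cvec.span U"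
    (is "?w \<in> _")
proof (rule ccontr)
  let ?E = "exponents {0..n} d"
  assume nw: "?w \<notin> cvec.span U"
  then obtain c where c: "\<And>s. s \<in> U \<Longrightarrow> (\<Sum>\<alpha>\<in>?E. c \<alpha> * s \<alpha>) = 0"
    "(\<Sum>\<alpha>\<in>?E. c \<alpha> * ?w \<alpha>) \<noteq> 0"
    using separating_functional[OF finite_exponents[OF finite_atLeastAtMost] U veronese_deriv_in nw] by blast
  have c_span: "(\<Sum>\<alpha>\<in>?E. c \<alpha> * x \<alpha>) = 0" if "x \<in> cvec.span U" for x
    using that
  proof (induction rule: cvec.span_induct_alt)
    case (step a x y)
    have "(\<Sum>\<alpha>\<in>?E. c \<alpha> * (a * x \<alpha> + y \<alpha>)) =
        a * (\<Sum>\<alpha>\<in>?E. c \<alpha> * x \<alpha>) + (\<Sum>\<alpha>\<in>?E. c \<alpha> * y \<alpha>)"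
      by (simp add: distrib_left sum.distrib sum_distrib_left mult_ac)
    then show ?case using step c(1) by simp
  qed simp
  define G where "G = (\<lambda>v. \<Sum>\<alpha>\<in>?E. c \<alpha> * dmonom {0..n} \<alpha> v u)"
  have G: "G \<in> forms {0..n} (d - 1)"
    unfolding G_def using d by (intro forms_sum forms_scale dmonom_form) auto
  have G_eq: "G v = (\<Sum>\<alpha>\<in>?E. c \<alpha> * veronese_deriv n d v u \<alpha>)" for v
    unfolding G_def by (rule sum.cong) (simp_all add: veronese_deriv_def)
  define x where "x = (\<lambda>a b i. if i = (0::nat) then a else if i = 1 then b else 0 :: complex)"
  obtain p where p: "degree p \<le> d - 1" "\<And>t. G (\<lambda>i. x 1 0 i + t * x 0 1 i) = poly p t"
    using poly_form_on_line[OF finite_atLeastAtMost G] by blast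
  have x1: "(\<lambda>i. x 1 0 i + t * x 0 1 i) = x 1 t" for t by (auto simp: x_def)
  have p0: "poly p k = 0" if k: "k \<in> K" for k
  proof -
    have "G (x 1 k) = 0" unfolding G_eq by (rule c_span) (use span[OF k] in \<open>simp add: x_def\<close>)
    then show ?thesis using p(2)[of k] by (simp only: x1)
  qed
  have "p = 0"
  proof (rule ccontr)
    assume "p \<noteq> 0"
    have "card K \<le> card {t. poly p t = 0}"
      using p0 poly_roots_finite[OF \<open>p \<noteq> 0\<close>] by (intro card_mono) auto
    also have "\<dots> \<le> degree p" by (rule card_poly_roots_bound[OF \<open>p \<noteq> 0\<close>])
    finally show False using p(1) K(2) d by simp
  qed
  then have G1: "G (x 1 t) = 0" for t using p(2)[of t] by (simp only: x1 poly_0)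
  have Gnz: "G (x s t) = 0" if "s \<noteq> 0" for s t
  proof -
    have "x s t = (\<lambda>i. s * x 1 (t / s) i)" using that by (auto simp: x_def)
    then show ?thesis using forms_homogeneous[OF G, of s "x 1 (t / s)"] G1 by simp
  qed
  \<comment> \<open>Points with first coordinate 0 are not multiples of any \<open>x 1 t\<close>.
    Here \<open>x 0 b\<close> is the value at 0 of a line on which \<open>G\<close> vanishes at all
    other parameters; the factor \<open>[:0, 1:]\<close> below supplies the root at 0.\<close>
  obtain q where q: "\<And>t. G (\<lambda>i. x 0 b i + t * x 1 0 i) = poly q t"
    using poly_form_on_line[OF finite_atLeastAtMost G] by blast
  have x2: "(\<lambda>i. x 0 b i + t * x 1 0 i) = x t b" for t by (auto simp: x_def)
  have q': "poly q t = G (x t b)" for t using q[of t] by (simp only: x2)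
  have "poly (q * [:0, 1:]) t = 0" for t
    using Gnz[of t b] by (cases "t = 0") (simp_all add: q')
  then have "q * [:0, 1:] = 0" using poly_all_0_iff_0 by blast
  then have "q = 0" by simp
  then have "G (x a b) = 0" using q'[of a] by simp
  then show False using c(2) unfolding G_eq x_def by simp
qed

lemma base_loci_veronese_nonempty:
  assumes n: "n \<ge> 2" and d: "d \<ge> 2" and rd: "r \<ge> d"
  shows "strong_base_locus (exponents {0..n} d) (veronese_variety n d) r \<noteq> {}"
    and "contact_base_locus (exponents {0..n} d) (veronese_variety n d) r \<noteq> {}"
proof -
  let ?E = "exponents {0..n} d" and ?V = "veronese_variety n d"
  have d1: "d \<ge> 1" using d by simp
  define x where "x = (\<lambda>a b i. if i = (0::nat) then a else if i = 1 then b else 0 :: complex)"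
  define P where "P = (\<lambda>t. cvec.span {veronese_vec n d (x 1 t)})"
  \<comment> \<open>The parameters start at 1, which keeps \<open>P 0\<close> free as the additional
    point required by the strong base locus.\<close>
  define A where "A = (\<lambda>k. P (of_nat k)) ` {1..r}"
  have x_in: "x 1 t \<in> coord_space {0..n}" "x 1 t \<noteq> 0" for t
    using n by (auto simp: x_def coord_space_def fun_eq_iff)
  have P_V: "P t \<in> ?V" for t using x_in by (auto simp: P_def veronese_variety_eq)
  have P_inj: "s = t" if "P s = P t" for s t
  proof -
    have "veronese_vec n d (x 1 s) \<in> P t" using that cvec.span_base by (auto simp: P_def)
    then obtain c where c: "veronese_vec n d (x 1 s) = (\<lambda>\<alpha>. c * veronese_vec n d (x 1 t) \<alpha>)"
      by (auto simp: P_def cvec.span_singleton)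
    \<comment> \<open>At these points the coordinate of x_0^d is 1, which fixes the scalar, and that
      of x_0^(d-1) x_1 is then the parameter.\<close>
    have "1 = c" using fun_cong[OF c, of "star_exponent d 0 0"] n by (simp add: veronese_vec_star[OF d1] x_def)
    then show ?thesis
      using fun_cong[OF c, of "star_exponent d 0 1"] n by (simp add: veronese_vec_star[OF d1] x_def)
  qed
  have T: "tangent_space ?E ?V (P t) = range (veronese_deriv n d (x 1 t))" for t
    unfolding P_def by (rule tangent_space_veronese[OF d x_in])
  have A_V: "A \<subseteq> ?V" using P_V by (auto simp: A_def)
  have "inj_on (\<lambda>k. P (of_nat k)) {1..r}" by (auto intro!: inj_onI dest: P_inj)
  then have "card A = r" by (simp add: A_def card_image)
  then have A: "A \<in> smooth_subsets ?E ?V r"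
    using A_V by (simp add: smooth_subsets_def smooth_locus_veronese_variety[OF d] A_def)
  define U where "U = (\<Union>p\<in>A. tangent_space ?E ?V p)"
  have dsp: "double_span ?E ?V A = cvec.span U" by (simp add: double_span_def U_def)
  have U: "U \<subseteq> coord_space ?E" by (auto simp: U_def tangent_space_def)
  have line: "veronese_deriv n d (x a b) u \<in> cvec.span U" for a b u
    unfolding x_def
  proof (rule veronese_deriv_in_span_line[OF d1 _ _ _ U])
    let ?K = "of_nat ` {1..r} :: complex set"
    show "finite ?K" by simp
    show "d \<le> card ?K" using rd by (subst card_image) (auto intro: inj_onI)
    fix k :: complex and u assume "k \<in> ?K"
    then have "P k \<in> A" by (auto simp: A_def)
    moreover have "veronese_deriv n d (x 1 k) u \<in> tangent_space ?E ?V (P k)" using T by simp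
    ultimately have "veronese_deriv n d (x 1 k) u \<in> U" unfolding U_def by blast
    then show "veronese_deriv n d (\<lambda>i. if i = 0 then 1 else if i = 1 then k else 0) u \<in> cvec.span U"
      unfolding x_def by (rule cvec.span_base)
  qed
  have proper: "double_span ?E ?V A \<noteq> coord_space ?E"
  proof
    assume eq: "double_span ?E ?V A = coord_space ?E"
    \<comment> \<open>The exponent of x_0^(d-2) x_2^2, which is singular wherever x_2 = 0 and thus
      along the line; hence the coordinate \<open>\<alpha>\<close> vanishes on all of
      \<open>U\<close>. The index 2 exists by \<open>n \<ge> 2\<close>.\<close>
    define \<alpha> :: "nat \<Rightarrow> nat" where "\<alpha> = (\<lambda>i. (if i = 0 then d - 2 else 0) + (if i = 2 then 2 else 0))"
    have \<alpha>: "\<alpha> \<in> ?E" using n d by (auto simp: \<alpha>_def exponents_def sum.distrib)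
    have "dmonom {0..n} \<alpha> (x 1 t) u = 0" for t u
      unfolding dmonom_def
    proof (rule sum.neutral, rule ballI)
      fix i assume i: "i \<in> {0..n}"
      have "(\<Prod>j\<in>{0..n} - {i}. x 1 t j ^ \<alpha> j) = 0" if "i \<noteq> 2"
        by (rule prod_zero) (use that n in \<open>auto intro!: bexI[of _ 2] simp: x_def \<alpha>_def\<close>)
      then show "of_nat (\<alpha> i) * x 1 t i ^ (\<alpha> i - 1) * u i * (\<Prod>j\<in>{0..n} - {i}. x 1 t j ^ \<alpha> j) = 0"
        by (cases "i = 2") (simp_all add: x_def \<alpha>_def)
    qed
    then have "y \<alpha> = 0" if "y \<in> U" for y
      using that T \<alpha> by (auto simp: U_def A_def veronese_deriv_def)
    then have "U \<subseteq> {y. y \<alpha> = 0}" by blast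
    then have "cvec.span U \<subseteq> {y. y \<alpha> = 0}" by (rule cvec.span_minimal) (simp add: cvec.subspace_def)
    moreover have "(\<lambda>\<beta>. if \<beta> = \<alpha> then 1 else 0) \<in> cvec.span U"
      using \<alpha> eq by (simp add: dsp coord_space_def)
    ultimately show False by auto
  qed
  have "P 0 \<in> ?V - A" using P_V P_inj[of 0] by (force simp: A_def)
  moreover have "double_span ?E ?V (A \<union> {P 0}) = double_span ?E ?V A"
  proof -
    have "tangent_space ?E ?V (P 0) \<subseteq> cvec.span U" using T line by auto
    then have "cvec.span (U \<union> tangent_space ?E ?V (P 0)) = cvec.span U"
      unfolding cvec.span_eq using cvec.span_superset[of U] cvec.span_mono[of U "U \<union> _"] by auto
    moreover have "(\<Union>p\<in>A \<union> {P 0}. tangent_space ?E ?V p) = U \<union> tangent_space ?E ?V (P 0)"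
      by (auto simp: U_def)
    ultimately show ?thesis unfolding dsp by (simp add: double_span_def)
  qed
  ultimately have "A \<in> strong_base_locus ?E ?V r"
    using A proper unfolding strong_base_locus_def smooth_locus_veronese_variety[OF d] by blast
  then show "strong_base_locus ?E ?V r \<noteq> {}" by blast
  have "veronese_flat n d 1 \<subseteq> contact_locus ?E ?V A"
  proof
    fix p assume "p \<in> veronese_flat n d 1"
    then obtain v where v: "v \<in> coord_space {0..1}" "v \<noteq> 0" "p = cvec.span {veronese_vec n d v}"
      by (auto simp: veronese_flat_def)
    have vx: "v = x (v 0) (v 1)" using v(1) by (auto simp: x_def coord_space_def)
    have vn: "v \<in> coord_space {0..n}" using v(1) n by (auto simp: coord_space_def)
    have "tangent_space ?E ?V p \<subseteq> cvec.span U"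
      unfolding v(3) tangent_space_veronese[OF d vn v(2)] using line[of "v 0" "v 1"] vx by auto
    moreover have "p \<in> ?V" using vn v by (auto simp: veronese_variety_eq)
    ultimately show "p \<in> contact_locus ?E ?V A"
      by (simp add: contact_locus_def dsp smooth_locus_veronese_variety[OF d])
  qed
  moreover have "contact_locus ?E ?V A \<subseteq> ?V"
    by (auto simp: contact_locus_def smooth_locus_veronese_variety[OF d])
  ultimately have "enat 1 \<le> zdim ?E (contact_locus ?E ?V A)"
    using n by (intro zdim_ge_veronese_flat[OF d1]) auto
  then have "zdim ?E (contact_locus ?E ?V A) > 0"
    by (metis i0_less le_zero_eq one_enat_def zero_neq_one)
  then have "A \<in> contact_base_locus ?E ?V r" using A proper by (simp add: contact_base_locus_def)
  then show "contact_base_locus ?E ?V r \<noteq> {}" by blast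
qed

section \<open>Singular forms avoiding a point\<close>

text \<open>\<open>F\<close> lies in the square of the ideal of the point. Having the value among
  the conditions makes the notion stable under multiplication by forms.\<close>

definition singular_at :: "(('i \<Rightarrow> complex) \<Rightarrow> complex) \<Rightarrow> ('i \<Rightarrow> complex) \<Rightarrow> bool" where
  "singular_at F v \<longleftrightarrow> F v = 0 \<and>
    (\<forall>u. ((\<lambda>t. F (\<lambda>i. v i + t * u i)) has_field_derivative 0) (at 0))"

lemma form_differentiable:
  assumes "finite I" "F \<in> forms I e"
  obtains D where "((\<lambda>t. F (\<lambda>i. v i + t * u i)) has_field_derivative D) (at 0)"
proof -
  obtain p where p: "\<And>t. F (\<lambda>i. v i + t * u i) = poly p t"
    using poly_form_on_line[OF assms] by blast
  show thesis by (rule that[of "poly (pderiv p) 0"]) (simp only: p poly_DERIV)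
qed

lemma singular_at_mult_right:
  assumes I: "finite I" and G: "G \<in> forms I e" and F: "singular_at F v"
  shows "singular_at (\<lambda>x. F x * G x) v"
  unfolding singular_at_def
proof (intro conjI allI)
  fix u
  obtain D where D: "((\<lambda>t. G (\<lambda>i. v i + t * u i)) has_field_derivative D) (at 0)"
    using form_differentiable[OF I G] .
  have "((\<lambda>t. F (\<lambda>i. v i + t * u i)) has_field_derivative 0) (at 0)" using F by (simp add: singular_at_def)
  from DERIV_mult[OF this D] F
  show "((\<lambda>t. F (\<lambda>i. v i + t * u i) * G (\<lambda>i. v i + t * u i)) has_field_derivative 0) (at 0)"
    by (simp add: singular_at_def)
qed (use F in \<open>simp add: singular_at_def\<close>)

lemma singular_at_mult:
  assumes I: "finite I" and F: "F \<in> forms I d" "F v = 0" and G: "G \<in> forms I e" "G v = 0"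
  shows "singular_at (\<lambda>x. F x * G x) v"
  unfolding singular_at_def
proof (intro conjI allI)
  fix u
  obtain D where D: "((\<lambda>t. F (\<lambda>i. v i + t * u i)) has_field_derivative D) (at 0)"
    using form_differentiable[OF I F(1)] .
  obtain D' where D': "((\<lambda>t. G (\<lambda>i. v i + t * u i)) has_field_derivative D') (at 0)"
    using form_differentiable[OF I G(1)] .
  from DERIV_mult[OF D D'] F(2) G(2)
  show "((\<lambda>t. F (\<lambda>i. v i + t * u i) * G (\<lambda>i. v i + t * u i)) has_field_derivative 0) (at 0)" by simp
qed (use F in simp)

lemma not_singular_at_mult:
  assumes I: "finite I" and F: "F \<in> forms I d" "\<not> singular_at F v" and G: "G \<in> forms I e" "G v \<noteq> 0"
  shows "\<not> singular_at (\<lambda>x. F x * G x) v"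
proof
  assume s: "singular_at (\<lambda>x. F x * G x) v"
  then have F0: "F v = 0" using G(2) by (simp add: singular_at_def)
  have "((\<lambda>t. F (\<lambda>i. v i + t * u i)) has_field_derivative 0) (at 0)" for u
  proof -
    obtain D where D: "((\<lambda>t. F (\<lambda>i. v i + t * u i)) has_field_derivative D) (at 0)"
      using form_differentiable[OF I F(1)] .
    obtain D' where D': "((\<lambda>t. G (\<lambda>i. v i + t * u i)) has_field_derivative D') (at 0)"
      using form_differentiable[OF I G(1)] .
    have "((\<lambda>t. F (\<lambda>i. v i + t * u i) * G (\<lambda>i. v i + t * u i)) has_field_derivative D * G v) (at 0)"
      using DERIV_mult[OF D D'] F0 by simp
    moreover have "((\<lambda>t. F (\<lambda>i. v i + t * u i) * G (\<lambda>i. v i + t * u i)) has_field_derivative 0) (at 0)"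
      using s by (simp add: singular_at_def)
    ultimately have "D * G v = 0" by (rule DERIV_unique)
    then show ?thesis using D G(2) by simp
  qed
  with F0 F(2) show False by (simp add: singular_at_def)
qed

text \<open>Euler's relation: if \<open>F v\<close> is nonzero, the derivative in the direction of
  \<open>v\<close> itself is \<open>of_nat d * F v\<close>. Failure of singularity is thus always
  seen by a tangent vector.\<close>

lemma not_singular_at_derivative:
  assumes I: "finite I" and F: "F \<in> forms I d" "\<not> singular_at F v" and d: "d \<ge> 1"
  obtains u where "\<not> ((\<lambda>t. F (\<lambda>i. v i + t * u i)) has_field_derivative 0) (at 0)"
proof (cases "F v = 0")
  case True
  with F(2) that show thesis by (auto simp: singular_at_def)
next
  case False
  have "(\<lambda>i. v i + t * v i) = (\<lambda>i. (1 + t) * v i)" for t by (simp add: algebra_simps)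
  then have eq: "F (\<lambda>i. v i + t * v i) = (1 + t) ^ d * F v" for t
    using forms_homogeneous[OF F(1), of "1 + t" v] by simp
  have "((\<lambda>t. (1 + t) ^ d * F v) has_field_derivative of_nat d * F v) (at 0)"
    by (auto intro!: derivative_eq_intros)
  then have "((\<lambda>t. F (\<lambda>i. v i + t * v i)) has_field_derivative of_nat d * F v) (at 0)" by (simp only: eq)
  moreover have "of_nat d * F v \<noteq> 0" using False d by simp
  ultimately show thesis using that[of v] DERIV_unique by blast
qed

lemma linear_forms: "finite I \<Longrightarrow> (\<lambda>x. \<Sum>i\<in>I. c i * x i) \<in> forms I 1"
  by (intro forms_sum forms_scale forms_coord)

text \<open>Two points of the finite set not collinear with the given point are absorbed by the square of
  a linear form; if no such pair is left, all of them lie on one line through the given point, and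
  the product of a linear form vanishing on this line with one linear form for each of them works.\<close>

lemma singular_form_avoiding_point:
  fixes n :: nat
  assumes n: "n \<ge> 2" and w: "w \<in> coord_space {0..n}" "w \<noteq> 0"
  shows "finite A \<Longrightarrow> A \<subseteq> proj_space {0..n} \<Longrightarrow> cvec.span {w} \<notin> A \<Longrightarrow> card A < d \<Longrightarrow>
    \<exists>F\<in>forms {0..n} d. (\<forall>p\<in>A. \<forall>v\<in>p - {0}. singular_at F v) \<and> \<not> singular_at F w"
proof (induction d arbitrary: A rule: less_induct)
  case (less d)
  let ?I = "{0..n}"
  have I: "finite ?I" by simp
  have q: "cvec.span {w} \<in> proj_space ?I" using w by (auto simp: proj_space_def)
  obtain l where l: "w l \<noteq> 0" using w(2) by (auto simp: fun_eq_iff)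
  then have lI: "l \<in> ?I" using w(1) by (auto simp: coord_space_def)
  define L where "L = (\<lambda>x::nat \<Rightarrow> complex. x l)"
  have L: "(\<lambda>x. L x ^ k) \<in> forms ?I k" "L w ^ k \<noteq> 0" for k
    using forms_power[OF I forms_coord[OF I lI], of k] l by (simp_all add: L_def)
  have not_sing: "\<not> singular_at F v" if "F v \<noteq> 0" for F and v :: "nat \<Rightarrow> complex"
    using that by (simp add: singular_at_def)
  have "\<exists>F. F \<in> forms ?I 1 \<and> vanishes_on F {p} \<and> \<not> vanishes_on F {cvec.span {w}}" if "p \<in> A" for p
  proof -
    have "p \<in> proj_space ?I" "p \<noteq> cvec.span {w}" using that less.prems by auto
    from linear_form_separating[OF I this(1) q this(2)] show ?thesis by blast
  qed
  then obtain M where M: "\<And>p. p \<in> A \<Longrightarrow> M p \<in> forms ?I 1"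
    "\<And>p. p \<in> A \<Longrightarrow> vanishes_on (M p) {p}" "\<And>p. p \<in> A \<Longrightarrow> \<not> vanishes_on (M p) {cvec.span {w}}"
    by metis
  have Mw: "M p w \<noteq> 0" if "p \<in> A" for p
    using M(3)[OF that] vanishes_on_span[OF M(1)[OF that] w(2)] by simp
  have M0: "M p v = 0" if "p \<in> A" "v \<in> p - {0}" for p v
    using M(2)[OF that(1)] that(2) by (simp add: vanishes_on_def)
  consider "A = {}" | a where "A = {a}" | a where "a \<in> A" "A \<noteq> {a}" by blast
  then show ?case
  proof cases
    case 1
    have "\<not> singular_at (\<lambda>x. L x ^ d) w" by (rule not_sing) (rule L(2))
    with 1 show ?thesis by (intro bexI[OF _ L(1)[of d]]) simp
  next
    case 2
    \<comment> \<open>As \<open>1 = card A < d\<close>, there is room for the square of a linear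
      form; a power of \<open>L\<close>, nonzero at \<open>w\<close>, fills up the degree.\<close>
    obtain k where k: "d = 1 + 1 + k" using less.prems(4) 2 by (intro that[of "d - 2"]) simp
    let ?F = "\<lambda>x. M a x * M a x * L x ^ k"
    have "?F \<in> forms ?I d" unfolding k by (intro forms_mult I M L) (simp_all add: 2)
    moreover have "singular_at ?F v" if "v \<in> a - {0}" for v
      using M(1) M0 that 2 by (intro singular_at_mult_right[OF I L(1)] singular_at_mult[OF I]) auto
    moreover have "\<not> singular_at ?F w" using Mw[of a] 2 L(2) by (intro not_sing) simp
    ultimately show ?thesis using 2 by blast
  next
    case 3
    obtain va where va: "va \<in> coord_space ?I" "va \<noteq> 0" "a = cvec.span {va}"
      using 3(1) less.prems(2) by (blast elim: proj_spaceE)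
    show ?thesis
    proof (cases "\<exists>c\<in>A - {a}. \<exists>H\<in>forms ?I 1. vanishes_on H {a} \<and> vanishes_on H {c} \<and> H w \<noteq> 0")
      case True
      then obtain c H where c: "c \<in> A" "c \<noteq> a" and H: "H \<in> forms ?I 1" "vanishes_on H {a}"
        "vanishes_on H {c}" "H w \<noteq> 0" by blast
      have "card {a, c} \<le> card A" using 3 c less.prems(1) by (intro card_mono) auto
      then have two: "2 \<le> card A" using c by simp
      have "card (A - {a, c}) = card A - card {a, c}" using 3 c by (intro card_Diff_subset) auto
      \<comment> \<open>The square of \<open>H\<close> costs degree 2 and disposes of two points, so
        the strict inequality survives.\<close>
      then have "card (A - {a, c}) < d - 2" using less.prems(4) two c by simp
      moreover have "d - 2 < d" "finite (A - {a, c})" "A - {a, c} \<subseteq> proj_space ?I"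
        "cvec.span {w} \<notin> A - {a, c}" using less.prems by auto
      ultimately have "\<exists>F\<in>forms ?I (d - 2).
          (\<forall>p\<in>A - {a, c}. \<forall>v\<in>p - {0}. singular_at F v) \<and> \<not> singular_at F w"
        by (intro less.IH)
      then obtain F where F: "F \<in> forms ?I (d - 2)" "\<not> singular_at F w"
        "\<And>p v. p \<in> A - {a, c} \<Longrightarrow> v \<in> p - {0} \<Longrightarrow> singular_at F v"
        by blast
      let ?F = "\<lambda>x. F x * H x * H x"
      have FH: "(\<lambda>x. F x * H x) \<in> forms ?I (d - 2 + 1)" by (intro forms_mult I F H)
      have "?F \<in> forms ?I (d - 2 + 1 + 1)" by (intro forms_mult I F H)
      moreover have "d - 2 + 1 + 1 = d" using two less.prems(4) by simp
      ultimately have F': "?F \<in> forms ?I d" by (simp only:)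
      have "singular_at ?F v" if p: "p \<in> A" "v \<in> p - {0}" for p v
      proof (cases "p \<in> {a, c}")
        case True
        then have "H v = 0" using H(2,3) p(2) by (auto simp: vanishes_on_def)
        then show ?thesis by (intro singular_at_mult[OF I FH _ H(1)]) simp_all
      next
        case False
        then show ?thesis
          using F(3) p by (intro singular_at_mult_right[OF I H(1)]) simp_all
      qed
      moreover have "\<not> singular_at ?F w"
        by (intro not_singular_at_mult[OF I FH _ H(1,4)] not_singular_at_mult[OF I F(1,2) H(1,4)])
      ultimately show ?thesis using F' by blast
    next
      case False
      \<comment> \<open>Two linear conditions, \<open>True\<close> standing for \<open>va\<close>
        and \<open>False\<close> for \<open>w\<close>, on at least three coefficients leave a
        nonzero linear form through both points.\<close>
      have "card {True, False} < card ?I" using n by simp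
      then obtain h where h: "\<exists>i\<in>?I. h i \<noteq> 0"
        "\<And>b. b \<in> {True, False} \<Longrightarrow> (\<Sum>i\<in>?I. h i * (if b then va i else w i)) = 0"
        using homogeneous_system_nontrivial_solution[OF I, of "{True, False}" "\<lambda>i b. if b then va i else w i"]
        by blast
      define H where "H = (\<lambda>x. \<Sum>i\<in>?I. h i * x i)"
      have H: "H \<in> forms ?I 1" unfolding H_def by (rule linear_forms[OF I])
      have H_line: "H (\<lambda>i. s * x i + t * y i) = s * H x + t * H y" for s t x y
        by (simp add: H_def sum.distrib sum_distrib_left algebra_simps)
      have Hva: "H va = 0" using h(2)[of True] by (simp add: H_def)
      have Hw: "H w = 0" using h(2)[of False] by (simp add: H_def)
      have HA: "vanishes_on H {c}" if c: "c \<in> A" for c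
      proof (cases "c = a")
        case True
        then show ?thesis using Hva va vanishes_on_span[OF H va(2)] by simp
      next
        case ca: False
        obtain vc where vc: "vc \<in> coord_space ?I" "vc \<noteq> 0" "c = cvec.span {vc}"
          using c less.prems(2) by (blast elim: proj_spaceE)
        \<comment> \<open>Otherwise a linear form would vanish at \<open>a\<close> and
          \<open>c\<close> but not at \<open>w\<close>, which is excluded in this case. In the
          resulting combination the coefficient of \<open>vc\<close> is nonzero because
          \<open>w\<close> does not represent \<open>a\<close>, and this carries the vanishing of
          \<open>H\<close> over to \<open>c\<close>.\<close>
        have "w \<in> cvec.span {va, vc}"
        proof (rule ccontr)
          assume nw: "w \<notin> cvec.span {va, vc}"
          have "{va, vc} \<subseteq> coord_space ?I" using va(1) vc(1) by simp
          then obtain k where k: "\<And>s. s \<in> {va, vc} \<Longrightarrow> (\<Sum>i\<in>?I. k i * s i) = 0"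
            "(\<Sum>i\<in>?I. k i * w i) \<noteq> 0"
            using separating_functional[OF I _ w(1) nw] by blast
          have K: "(\<lambda>x. \<Sum>i\<in>?I. k i * x i) \<in> forms ?I 1" by (rule linear_forms[OF I])
          have "vanishes_on (\<lambda>x. \<Sum>i\<in>?I. k i * x i) {a}" "vanishes_on (\<lambda>x. \<Sum>i\<in>?I. k i * x i) {c}"
            using k(1) va vc by (simp_all add: vanishes_on_span[OF K])
          with K k(2) False c ca show False by blast
        qed
        then obtain s where "w - (\<lambda>i. s * va i) \<in> cvec.span {vc}" unfolding cvec.span_breakdown_eq by blast
        then obtain t where t: "w - (\<lambda>i. s * va i) = (\<lambda>i. t * vc i)" by (auto simp: cvec.span_singleton)
        have wst: "w = (\<lambda>i. s * va i + t * vc i)"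
        proof
          show "w i = s * va i + t * vc i" for i using fun_cong[OF t, of i] by (simp add: diff_eq_eq add.commute)
        qed
        have "t \<noteq> 0"
        proof
          assume "t = 0"
          then have "w = (\<lambda>i. s * va i)" using wst by simp
          then have "w \<in> a" unfolding va(3) cvec.span_singleton by blast
          then show False using M0[OF 3(1), of w] Mw[OF 3(1)] w(2) by simp
        qed
        moreover have "s * H va + t * H vc = 0" using H_line[of s va t vc] Hw wst by simp
        ultimately have "H vc = 0" using Hva by simp
        then show ?thesis using vc vanishes_on_span[OF H vc(2)] by simp
      qed
      \<comment> \<open>The degrees \<open>1 + card A + k\<close> add up to \<open>d\<close> because
        \<open>card A \<le> d - 1\<close>. Each point of \<open>A\<close> is a zero of
        \<open>H\<close> and of one factor \<open>M p\<close>, hence a singular point of the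
        product.\<close>
      define k where "k = d - 1 - card A"
      let ?G = "\<lambda>x. (\<Prod>p\<in>A. M p x) * L x ^ k"
      let ?F = "\<lambda>x. H x * ?G x"
      have G: "?G \<in> forms ?I ((\<Sum>p\<in>A. 1) + k)" by (intro forms_mult forms_prod I M L)
      have "?F \<in> forms ?I (1 + ((\<Sum>p\<in>A. 1) + k))" by (intro forms_mult I H G)
      moreover have "1 + ((\<Sum>p\<in>A. 1) + k) = d" using less.prems(4) by (simp add: k_def)
      ultimately have F: "?F \<in> forms ?I d" by (simp only:)
      have "singular_at ?F v" if p: "p \<in> A" "v \<in> p - {0}" for p v
      proof (rule singular_at_mult[OF I H _ G])
        show "H v = 0" using HA[OF p(1)] p(2) by (simp add: vanishes_on_def)
        have "(\<Prod>p\<in>A. M p v) = 0"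
          using less.prems(1) p(1) M0[OF p] by (intro prod_zero) auto
        then show "(\<Prod>p\<in>A. M p v) * L v ^ k = 0" by simp
      qed
      moreover have "\<not> singular_at ?F w"
      proof (rule not_singular_at_mult[OF I H _ G])
        show "(\<Prod>p\<in>A. M p w) * L w ^ k \<noteq> 0" using Mw L(2) less.prems(1) by simp
        \<comment> \<open>\<open>w\<close> is only a simple zero of \<open>H\<close>: the derivative
          in a coordinate direction with nonzero coefficient is that coefficient.\<close>
        obtain j where j: "j \<in> ?I" "h j \<noteq> 0" using h(1) by blast
        define u where "u = (\<lambda>i. if i = j then 1 else 0 :: complex)"
        have Hu: "H u = h j"
          using j(1) by (simp add: H_def u_def if_distrib[of "\<lambda>x. _ * x"] cong: if_cong)
        have "H (\<lambda>i. w i + t * u i) = t * h j" for t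
          using H_line[of 1 w t u] Hw Hu by simp
        then have "((\<lambda>t. H (\<lambda>i. w i + t * u i)) has_field_derivative h j) (at 0)"
          by (auto intro!: derivative_eq_intros)
        with j(2) show "\<not> singular_at H w"
          unfolding singular_at_def using DERIV_unique by blast
      qed
      ultimately show ?thesis using F by blast
    qed
  qed
qed

section \<open>Emptiness of the loci for fewer than \<open>d\<close> points\<close>

text \<open>The coefficients of a form \<open>F\<close> singular over \<open>A\<close>, but not over
  \<open>q\<close>, define a functional \<open>\<phi>\<close> whose value on
  \<open>veronese_deriv n d x u\<close> is the derivative of \<open>F\<close> at \<open>x\<close>
  along \<open>u\<close>. It kills the span belonging to \<open>A\<close>, but not the tangent space
  at \<open>q\<close>.\<close>

lemma tangent_space_not_subset_double_span:
  assumes n: "n \<ge> 2" and d: "d \<ge> 2" and A: "A \<subseteq> veronese_variety n d" "finite A" "card A < d"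
    and q: "q \<in> veronese_variety n d - A"
  shows "\<not> tangent_space (exponents {0..n} d) (veronese_variety n d) q
    \<subseteq> double_span (exponents {0..n} d) (veronese_variety n d) A"
proof
  let ?E = "exponents {0..n} d" and ?V = "veronese_variety n d" and ?I = "{0..n}"
  assume sub: "tangent_space ?E ?V q \<subseteq> double_span ?E ?V A"
  have I: "finite ?I" by simp
  obtain w where w: "w \<in> coord_space ?I" "w \<noteq> 0" "q = cvec.span {veronese_vec n d w}"
    using q by (auto simp: veronese_variety_eq)
  have "\<forall>p\<in>A. \<exists>v. v \<in> coord_space ?I \<and> v \<noteq> 0 \<and> p = cvec.span {veronese_vec n d v}"
    using A(1) by (auto simp: veronese_variety_eq)
  then obtain v where v: "\<And>p. p \<in> A \<Longrightarrow> v p \<in> coord_space ?I" "\<And>p. p \<in> A \<Longrightarrow> v p \<noteq> 0"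
    "\<And>p. p \<in> A \<Longrightarrow> p = cvec.span {veronese_vec n d (v p)}" by metis
  define B where "B = (\<lambda>p. cvec.span {v p}) ` A"
  have "finite B" using A(2) by (simp add: B_def)
  moreover have "B \<subseteq> proj_space ?I" using v by (auto simp: B_def proj_space_def)
  moreover have "cvec.span {w} \<notin> B"
  proof
    assume "cvec.span {w} \<in> B"
    then obtain p where p: "p \<in> A" "cvec.span {w} = cvec.span {v p}" by (auto simp: B_def)
    then have "q = p" using v(3)[OF p(1)] w(3) veronese_map_span by metis
    with p(1) q show False by simp
  qed
  moreover have "card B < d" unfolding B_def using card_image_le[OF A(2)] A(3) by (rule le_less_trans)
  ultimately have "\<exists>F\<in>forms ?I d. (\<forall>p\<in>B. \<forall>v\<in>p - {0}. singular_at F v) \<and> \<not> singular_at F w"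
    by (rule singular_form_avoiding_point[OF n w(1,2)])
  then obtain F where F: "F \<in> forms ?I d" "\<forall>p\<in>B. \<forall>v\<in>p - {0}. singular_at F v"
    "\<not> singular_at F w" by blast
  obtain c where c: "F = (\<lambda>x. \<Sum>\<alpha>\<in>?E. c \<alpha> * monom_eval ?I \<alpha> x)" using F(1) by (rule formsE)
  define \<phi> where "\<phi> = (\<lambda>y. \<Sum>\<alpha>\<in>?E. c \<alpha> * y \<alpha> :: complex)"
  have F_eq: "F x = (\<Sum>\<alpha>\<in>?E. c \<alpha> * veronese_vec n d x \<alpha>)" for x
    unfolding c by (rule sum.cong) (simp_all add: veronese_vec_def)
  have DF: "((\<lambda>t. F (\<lambda>i. x i + t * u i)) has_field_derivative \<phi> (veronese_deriv n d x u)) (at 0)" for x u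
    unfolding F_eq \<phi>_def by (intro DERIV_sum DERIV_cmult has_field_derivative_veronese_vec)
  have "\<phi> y = 0" if y: "y \<in> (\<Union>p\<in>A. tangent_space ?E ?V p)" for y
  proof -
    obtain p where p: "p \<in> A" "y \<in> tangent_space ?E ?V p" using y by blast
    then have "y \<in> tangent_space ?E ?V (cvec.span {veronese_vec n d (v p)})" using v(3) by simp
    then obtain u where u: "y = veronese_deriv n d (v p) u"
      unfolding tangent_space_veronese[OF d v(1,2)[OF p(1)]] by blast
    have "cvec.span {v p} \<in> B" "v p \<in> cvec.span {v p} - {0}"
      using p(1) v(2) by (auto simp: B_def cvec.span_base)
    then have "singular_at F (v p)" using F(2) by blast
    then show ?thesis using DF[of "v p" u] unfolding singular_at_def u by (blast dest: DERIV_unique)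
  qed
  then have "(\<Union>p\<in>A. tangent_space ?E ?V p) \<subseteq> {y. \<phi> y = 0}" by blast
  moreover have "cvec.subspace {y. \<phi> y = 0}"
    unfolding cvec.subspace_def \<phi>_def
    by (auto simp: distrib_left sum.distrib mult.left_commute[of _ "_::complex"] simp flip: sum_distrib_left)
  ultimately have "double_span ?E ?V A \<subseteq> {y. \<phi> y = 0}" unfolding double_span_def by (rule cvec.span_minimal)
  moreover have "range (veronese_deriv n d w) \<subseteq> double_span ?E ?V A"
    using sub unfolding w(3) tangent_space_veronese[OF d w(1,2)] .
  ultimately have "\<phi> (veronese_deriv n d w u) = 0" for u by blast
  then have "((\<lambda>t. F (\<lambda>i. w i + t * u i)) has_field_derivative 0) (at 0)" for u using DF[of w u] by simp
  moreover have "d \<ge> 1" using d by simp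
  ultimately show False using not_singular_at_derivative[OF I F(1,3)] by blast
qed

text \<open>Either locus would put the tangent space at a point outside \<open>A\<close> into the
  span: at the point \<open>q\<close> for the strong base locus, and for the contact locus because a
  set of positive dimension does not fit into the finite set \<open>A\<close>.\<close>

lemma base_loci_veronese_empty:
  assumes n: "n \<ge> 2" and d: "d \<ge> 2" and rd: "r < d"
  shows "strong_base_locus (exponents {0..n} d) (veronese_variety n d) r = {}"
    and "contact_base_locus (exponents {0..n} d) (veronese_variety n d) r = {}"
proof -
  let ?E = "exponents {0..n} d" and ?V = "veronese_variety n d"
  have *: "\<not> tangent_space ?E ?V q \<subseteq> double_span ?E ?V A"
    if "A \<in> smooth_subsets ?E ?V r" "q \<in> ?V - A" for A q
    using that rd tangent_space_not_subset_double_span[OF n d]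
    by (simp add: smooth_subsets_def smooth_locus_veronese_variety[OF d])
  show "strong_base_locus ?E ?V r = {}"
  proof (rule equals0I)
    fix A assume A: "A \<in> strong_base_locus ?E ?V r"
    then obtain q where q: "q \<in> ?V - A" "double_span ?E ?V (A \<union> {q}) = double_span ?E ?V A"
      by (auto simp: strong_base_locus_def smooth_locus_veronese_variety[OF d])
    have "tangent_space ?E ?V q \<subseteq> double_span ?E ?V (A \<union> {q})"
      unfolding double_span_def using cvec.span_superset by fast
    with q *[of A q] A show False by (simp add: strong_base_locus_def)
  qed
  show "contact_base_locus ?E ?V r = {}"
  proof (rule equals0I)
    fix A assume A: "A \<in> contact_base_locus ?E ?V r"
    then have AS: "A \<in> smooth_subsets ?E ?V r" by (simp add: contact_base_locus_def)
    have "contact_locus ?E ?V A \<subseteq> A"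
      using *[OF AS] by (auto simp: contact_locus_def smooth_locus_veronese_variety[OF d])
    moreover have "finite A" "A \<subseteq> ?V"
      using AS by (auto simp: smooth_subsets_def smooth_locus_veronese_variety[OF d])
    moreover have "?V \<subseteq> proj_space ?E" using d by (intro veronese_variety_subset) simp
    ultimately have "zdim ?E (contact_locus ?E ?V A) = 0"
      by (intro zdim_finite finite_exponents) (auto intro: finite_subset)
    with A show False by (simp add: contact_base_locus_def)
  qed
qed

theorem theorem3p8:
  fixes n d r :: nat
  assumes "n \<ge> 2" and "d \<ge> 2" and "r \<ge> 1"
  shows "(strong_base_locus (exponents {0..n} d) (veronese_variety n d) r \<noteq> {} \<longleftrightarrow> r \<ge> d) \<and>
         (contact_base_locus (exponents {0..n} d) (veronese_variety n d) r \<noteq> {} \<longleftrightarrow> r \<ge> d)"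
  using base_loci_veronese_nonempty[OF assms(1,2)] base_loci_veronese_empty[OF assms(1,2)]
  by (meson not_le)

end
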